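(* There exist a non-elementary purely loxodromic Fuchsian group $\Gamma$ and non-trivial subgroups $\Phi$ and $\Theta$ of $\Gamma$ such that $$\Lambda(\Phi\cap\Theta)\setminus\bigl(\Lambda_c(\Phi)\cap\Lambda_c(\Theta)\bigr)$$ is non-empty.
   Context: $\mathbb{H}^2$ is the hyperbolic plane with circle at infinity $\mathbb{S}^1_\infty$. A Fuchsian group is a discrete subgroup of the group $\mathrm{Isom}^+(\mathbb{H}^2)$ of orientation-preserving isometries of $\mathbb{H}^2$. It is purely loxodromic if it contains no parabolic or elliptic elements, i.e. every non-trivial element is loxodromic (hyperbolic). It is non-elementary if it is not virtually abelian. The limit set $\Lambda(G)\subseteq\mathbb{S}^1_\infty$ of a purely loxodromic Fuchsian group $G$ is the closure in $\mathbb{S}^1_\infty$ of the set of fixed points of loxodromic elements of $G$ (so it is empty if $G$ is trivial). A point $x\in\Lambda(G)$ is a conical limit point of $G$ if for every geodesic ray $r\subset\mathbb{H}^2$ with $x$ as its endpoint at infinity there exist a compact set $K\subset\mathbb{H}^2$ and a sequence $\{\gamma_k\}$ of distinct elements of $G$ such that $\gamma_k(K)\cap r$ is non-empty for all $k$. The set of conical limit points of $G$ is denoted $\Lambda_c(G)$. *)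

theory Defs
  imports "HOL-Analysis.Analysis" "HOL-Algebra.Coset" "HOL-Algebra.Bij"
begin

text \<open>
  The Poincare disc model: the hyperbolic plane is the open unit disc with the metric
  \<open>hdist\<close> of curvature \<open>-1\<close>, which induces the Euclidean topology on the disc; the circle at
  infinity is the unit circle, and the Euclidean topology on the closed disc is that of the
  standard compactification.
\<close>

definition hplane :: "complex set" where
  "hplane = ball 0 1"

definition circle_inf :: "complex set" where
  "circle_inf = sphere 0 1"

definition hdist :: "complex \<Rightarrow> complex \<Rightarrow> real" where
  "hdist z w =
     arcosh (1 + 2 * (cmod (z - w))\<^sup>2 / ((1 - (cmod z)\<^sup>2) * (1 - (cmod w)\<^sup>2)))"

text \<open>
  The number \<open>Im (cnj (f' 1) * f' \<i>)\<close> is the determinant of the real-linear map \<open>f'\<close> with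
  respect to the basis \<open>1, \<i>\<close>. Every isometry is smooth, so asking for differentiability
  excludes nothing.
\<close>

definition orientation_preserving :: "(complex \<Rightarrow> complex) \<Rightarrow> bool" where
  "orientation_preserving f \<longleftrightarrow>
     (\<forall>z\<in>hplane. \<exists>f'. (f has_derivative f') (at z) \<and> 0 < Im (cnj (f' 1) * f' \<i>))"

text \<open>
  Elements of \<open>Bij hplane\<close> are extensional, that is, equal to \<open>undefined\<close> off the disc, so
  that equality of functions is equality of maps of the hyperbolic plane.
\<close>

definition isom_plus :: "(complex \<Rightarrow> complex) monoid" where
  "isom_plus = (BijGroup hplane)\<lparr>carrier :=
     {f \<in> Bij hplane. (\<forall>z\<in>hplane. \<forall>w\<in>hplane. hdist (f z) (f w) = hdist z w) \<and>
                      orientation_preserving f}\<rparr>"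

lemma orientation_preserving_restrict_id:
  "orientation_preserving (\<lambda>z\<in>hplane. z)"
  unfolding orientation_preserving_def
proof
  fix z assume z: "z \<in> hplane"
  have "((\<lambda>z\<in>hplane. z) has_derivative (\<lambda>h. h)) (at z)"
    by (rule has_derivative_transform_within_open[OF has_derivative_ident, of hplane])
       (use z in \<open>auto simp: hplane_def\<close>)
  then show "\<exists>f'. ((\<lambda>z\<in>hplane. z) has_derivative f') (at z) \<and> 0 < Im (cnj (f' 1) * f' \<i>)"
    by (intro exI[of _ "\<lambda>h. h"]) auto
qed

lemma real_linear_complex_expand:
  fixes f :: "complex \<Rightarrow> complex"
  assumes "bounded_linear f"
  shows "f w = of_real (Re w) * f 1 + of_real (Im w) * f \<i>"
proof -
  interpret bounded_linear f by fact
  have "f w = f (Re w *\<^sub>R 1 + Im w *\<^sub>R \<i>)"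
    by (rule arg_cong[of _ _ f]) (simp add: complex_eq_iff)
  also have "\<dots> = Re w *\<^sub>R f 1 + Im w *\<^sub>R f \<i>"
    by (simp only: add scaleR)
  finally show ?thesis by (simp add: scaleR_conv_of_real)
qed

lemma orientation_preserving_compose:
  assumes f: "f \<in> hplane \<rightarrow> hplane" "orientation_preserving f" and g: "orientation_preserving g"
  shows "orientation_preserving (compose hplane g f)"
  unfolding orientation_preserving_def
proof
  fix z assume z: "z \<in> hplane"
  obtain f' where f': "(f has_derivative f') (at z)" "0 < Im (cnj (f' 1) * f' \<i>)"
    using f(2) z unfolding orientation_preserving_def by blast
  obtain g' where g': "(g has_derivative g') (at (f z))" "0 < Im (cnj (g' 1) * g' \<i>)"
    using g f(1) z unfolding orientation_preserving_def by blast
  have "((\<lambda>x. g (f x)) has_derivative (\<lambda>h. g' (f' h))) (at z)"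
    by (rule has_derivative_compose[OF f'(1) g'(1)])
  then have d: "(compose hplane g f has_derivative (\<lambda>h. g' (f' h))) (at z)"
    by (rule has_derivative_transform_within_open[of _ _ _ _ hplane])
       (use z in \<open>auto simp: hplane_def compose_def\<close>)
  note ex = real_linear_complex_expand[OF has_derivative_bounded_linear[OF g'(1)]]
  have "Im (cnj (g' (f' 1)) * g' (f' \<i>)) = Im (cnj (g' 1) * g' \<i>) * Im (cnj (f' 1) * f' \<i>)"
    unfolding ex[of "f' 1"] ex[of "f' \<i>"] by (simp add: algebra_simps)
  then show "\<exists>h'. (compose hplane g f has_derivative h') (at z) \<and> 0 < Im (cnj (h' 1) * h' \<i>)"
    using d f'(2) g'(2) by (intro exI[of _ "\<lambda>h. g' (f' h)"]) auto
qed

lemma orientation_preserving_inv: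
  assumes f: "f \<in> Bij hplane" "orientation_preserving f"
  shows "orientation_preserving (\<lambda>z\<in>hplane. inv_into hplane f z)"
  unfolding orientation_preserving_def
proof
  fix z assume z: "z \<in> hplane"
  have bij: "bij_betw f hplane hplane" using f(1) by (simp add: Bij_def)
  define w where "w = inv_into hplane f z"
  have w: "w \<in> hplane" "f w = z"
    using bij z unfolding w_def
    by (auto simp: bij_betw_def inv_into_into f_inv_into_f)
  obtain f' where f': "(f has_derivative f') (at w)" "0 < Im (cnj (f' 1) * f' \<i>)"
    using f(2) w unfolding orientation_preserving_def by blast
  define J where "J = Im (cnj (f' 1) * f' \<i>)"
  define g' where "g' = (\<lambda>h. Complex ((Im (f' \<i>) * Re h - Re (f' \<i>) * Im h) / J)
                              ((Re (f' 1) * Im h - Im (f' 1) * Re h) / J))"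
  have J: "J > 0" "J = Re (f' 1) * Im (f' \<i>) - Im (f' 1) * Re (f' \<i>)"
    using f'(2) by (auto simp: J_def)
  note ex = real_linear_complex_expand[OF has_derivative_bounded_linear[OF f'(1)]]
  have "f' (g' h) = h" for h
  proof -
    have "J * Re (f' (g' h)) = J * Re h" "J * Im (f' (g' h)) = J * Im h"
      unfolding ex[of "g' h"] using J(1)
      by (simp_all add: g'_def distrib_left) (simp_all add: J(2) algebra_simps)
    then show ?thesis using J(1) by (simp add: complex_eq_iff)
  qed
  then have id: "f' \<circ> g' = id" by auto
  have cont: "continuous_on hplane f"
    using f(2) unfolding orientation_preserving_def
    by (meson continuous_at_imp_continuous_on has_derivative_continuous)
  have "(inv_into hplane f has_derivative g') (at (f w))"
    by (rule has_derivative_inverse_strong[OF _ w(1) cont _ f'(1) id])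
       (use bij in \<open>auto simp: hplane_def bij_betw_def\<close>)
  then have d: "((\<lambda>z\<in>hplane. inv_into hplane f z) has_derivative g') (at z)"
    unfolding w(2)
    by (rule has_derivative_transform_within_open[of _ _ _ _ hplane])
       (use z in \<open>auto simp: hplane_def\<close>)
  have "Im (cnj (g' 1) * g' \<i>) = J / (J * J)"
    by (simp add: g'_def diff_divide_distrib [symmetric]) (simp add: J(2) mult.commute)
  then have "0 < Im (cnj (g' 1) * g' \<i>)" using J(1) by simp
  with d show "\<exists>h'. ((\<lambda>z\<in>hplane. inv_into hplane f z) has_derivative h') (at z) \<and>
                    0 < Im (cnj (h' 1) * h' \<i>)"
    by blast
qed

lemma subgroup_isom_plus: "subgroup (carrier isom_plus) (BijGroup hplane)"
proof (rule group.subgroupI[OF group_BijGroup])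
  show "carrier isom_plus \<subseteq> carrier (BijGroup hplane)"
    by (auto simp: isom_plus_def BijGroup_def)
  have "(\<lambda>z\<in>hplane. z) \<in> carrier isom_plus"
    using orientation_preserving_restrict_id by (auto simp: isom_plus_def id_Bij)
  then show "carrier isom_plus \<noteq> {}" by blast
next
  fix f assume f: "f \<in> carrier isom_plus"
  then have fB: "f \<in> Bij hplane" by (simp add: isom_plus_def)
  then have bij: "bij_betw f hplane hplane" by (simp add: Bij_def)
  have "hdist (inv_into hplane f z) (inv_into hplane f w) = hdist z w"
    if "z \<in> hplane" "w \<in> hplane" for z w
  proof -
    have "inv_into hplane f z \<in> hplane" "inv_into hplane f w \<in> hplane"
      using fB that by (auto intro: Bij_inv_into_mem)
    then have "hdist (f (inv_into hplane f z)) (f (inv_into hplane f w)) =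
               hdist (inv_into hplane f z) (inv_into hplane f w)"
      using f by (simp add: isom_plus_def)
    then show ?thesis using bij that by (simp add: bij_betw_def f_inv_into_f)
  qed
  then show "inv\<^bsub>BijGroup hplane\<^esub> f \<in> carrier isom_plus"
    using f fB orientation_preserving_inv[OF fB]
    by (auto simp: inv_BijGroup isom_plus_def restrict_inv_into_Bij)
next
  fix g f assume gf: "g \<in> carrier isom_plus" "f \<in> carrier isom_plus"
  then have B: "g \<in> Bij hplane" "f \<in> Bij hplane" by (auto simp: isom_plus_def)
  have f: "f \<in> hplane \<rightarrow> hplane" using B by (simp add: Bij_imp_funcset)
  have "hdist (compose hplane g f z) (compose hplane g f w) = hdist z w"
    if "z \<in> hplane" "w \<in> hplane" for z w
    using gf f that by (auto simp: isom_plus_def compose_def Pi_iff)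
  moreover have "orientation_preserving (compose hplane g f)"
    using gf f by (intro orientation_preserving_compose) (auto simp: isom_plus_def)
  ultimately show "g \<otimes>\<^bsub>BijGroup hplane\<^esub> f \<in> carrier isom_plus"
    using B by (simp add: BijGroup_def isom_plus_def compose_Bij)
qed

lemma group_isom_plus: "group isom_plus"
  using subgroup.subgroup_is_group[OF subgroup_isom_plus group_BijGroup]
  by (simp add: isom_plus_def)

text \<open>
  The topology on \<open>complex \<Rightarrow> complex\<close> is that of pointwise convergence. The elements of
  \<open>isom_plus\<close> agree off the disc, and for isometries pointwise convergence on the disc is
  locally uniform convergence; so \<open>discrete\<close> refers to the usual (compact-open) topology of the
  isometry group.
\<close>

definition fuchsian_group :: "(complex \<Rightarrow> complex) set \<Rightarrow> bool" where
  "fuchsian_group G \<longleftrightarrow> subgroup G isom_plus \<and> discrete G"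

text \<open>
  A point at infinity is fixed by an isometry if it is fixed by the continuous extension of the
  isometry to the closed disc.
\<close>

definition fixed_points_inf :: "(complex \<Rightarrow> complex) \<Rightarrow> complex set" where
  "fixed_points_inf g = {\<xi> \<in> circle_inf. (g \<longlongrightarrow> \<xi>) (at \<xi> within hplane)}"

definition loxodromic :: "(complex \<Rightarrow> complex) \<Rightarrow> bool" where
  "loxodromic g \<longleftrightarrow>
     g \<in> carrier isom_plus \<and> (\<forall>z\<in>hplane. g z \<noteq> z) \<and> card (fixed_points_inf g) = 2"

definition purely_loxodromic :: "(complex \<Rightarrow> complex) set \<Rightarrow> bool" where
  "purely_loxodromic G \<longleftrightarrow> (\<forall>g\<in>G. g \<noteq> \<one>\<^bsub>isom_plus\<^esub> \<longrightarrow> loxodromic g)"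

definition virtually_abelian :: "('a, 'b) monoid_scheme \<Rightarrow> bool" where
  "virtually_abelian G \<longleftrightarrow>
     (\<exists>H. subgroup H G \<and> comm_group (G\<lparr>carrier := H\<rparr>) \<and> finite (rcosets\<^bsub>G\<^esub> H))"

definition non_elementary :: "(complex \<Rightarrow> complex) set \<Rightarrow> bool" where
  "non_elementary G \<longleftrightarrow> \<not> virtually_abelian (isom_plus\<lparr>carrier := G\<rparr>)"

definition limit_set :: "(complex \<Rightarrow> complex) set \<Rightarrow> complex set" where
  "limit_set G = closure (\<Union>g\<in>{g \<in> G. loxodromic g}. fixed_points_inf g)"

definition geodesic_ray :: "(real \<Rightarrow> complex) \<Rightarrow> bool" where
  "geodesic_ray \<rho> \<longleftrightarrow> \<rho> \<in> {0..} \<rightarrow> hplane \<and> (\<forall>s\<ge>0. \<forall>t\<ge>0. hdist (\<rho> s) (\<rho> t) = \<bar>s - t\<bar>)"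

definition conical_limit_set :: "(complex \<Rightarrow> complex) set \<Rightarrow> complex set" where
  "conical_limit_set G =
     {x \<in> limit_set G.
        \<forall>\<rho>. geodesic_ray \<rho> \<and> (\<rho> \<longlongrightarrow> x) at_top \<longrightarrow>
          (\<exists>K \<gamma>. compact K \<and> K \<subseteq> hplane \<and> inj \<gamma> \<and> range \<gamma> \<subseteq> G \<and>
             (\<forall>k::nat. \<gamma> k ` K \<inter> \<rho> ` {0..} \<noteq> {}))}"

end

theory Submission
  imports Defs
begin

text \<open>
  The group \<open>\<Gamma>\<close> is free on two loxodromic elements \<open>a\<close> and \<open>b\<close>, and \<open>\<Phi> = \<Theta> = N\<close> is the kernel of
  the homomorphism \<open>height : \<Gamma> \<rightarrow> \<int>\<close> with \<open>a \<mapsto> 1\<close> and \<open>b \<mapsto> 0\<close>. The point in question is the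
  attracting fixed point of \<open>a\<close>, which is \<open>1\<close> after normalisation. It lies in the limit set of
  \<open>N\<close> because the conjugates \<open>a\<^sup>n b a\<^sup>-\<^sup>n\<close> belong to \<open>N\<close> and their attracting fixed points are the
  images under \<open>a\<^sup>n\<close> of that of \<open>b\<close>, which converge to \<open>1\<close> (\<open>one_in_limit_set\<close>). It is not a
  conical limit point, because the axis of \<open>a\<close> leaves every compact set of the infinite cyclic
  cover \<open>\<H>\<^sup>2/N\<close> of \<open>\<H>\<^sup>2/\<Gamma>\<close>. In detail, if \<open>\<gamma>\<^sub>k \<in> N\<close> are distinct and each \<open>\<gamma>\<^sub>k K\<close>
  meets the axis, then suitable \<open>a\<^sup>-\<^sup>n \<gamma>\<^sub>k\<close> with \<open>n = n\<^sub>k\<close> move \<open>K\<close> so that it meets one fixed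
  segment; only finitely many elements of \<open>\<Gamma>\<close> do that, but the height of
  \<open>a\<^sup>-\<^sup>n \<gamma>\<^sub>k\<close> is \<open>-n\<close>, so \<open>a\<^sup>-\<^sup>n \<gamma>\<^sub>k\<close> determines \<open>n\<close> and hence \<open>\<gamma>\<^sub>k\<close>
  (\<open>one_not_conical\<close>).

  Two independent arguments show that \<open>\<Gamma>\<close> has the required properties. The generators lie in
  \<open>SU(1,1)\<close> and their entries lie in the lattices \<open>\<int>[\<i>]\<close> and \<open>\<surd>3 \<int>[\<i>]\<close>, which makes \<open>\<Gamma>\<close> act
  properly discontinuously: a matrix that moves a point of a compact set into that set has bounded
  entries (\<open>finitely_many_meet_compact\<close>). The generators also play ping-pong with four cones of
  vectors, and this shows that a word either cancels cyclically to the empty word or has trace of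
  absolute value above \<open>2\<close> (\<open>word_trivial_or_hyperbolic\<close>). Hence \<open>\<Gamma>\<close> is purely loxodromic and
  \<open>height\<close>, which is defined on words, is well defined on \<open>\<Gamma>\<close>.
\<close>

section \<open>The group SU(1,1)\<close>

type_synonym cmat = "complex \<times> complex"

text \<open>
  A pair \<open>(\<alpha>, \<beta>)\<close> stands for the matrix with rows \<open>(\<alpha>, \<beta>)\<close> and \<open>(cnj \<beta>, cnj \<alpha>)\<close>, and \<open>su11\<close> is
  the condition that its determinant is \<open>1\<close>.
\<close>

definition su11 :: "cmat set" where
  "su11 = {(\<alpha>, \<beta>). (cmod \<alpha>)\<^sup>2 - (cmod \<beta>)\<^sup>2 = 1}"

fun mmul :: "cmat \<Rightarrow> cmat \<Rightarrow> cmat" where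
  "mmul (\<alpha>, \<beta>) (\<gamma>, \<delta>) = (\<alpha> * \<gamma> + \<beta> * cnj \<delta>, \<alpha> * \<delta> + \<beta> * cnj \<gamma>)"

fun minv :: "cmat \<Rightarrow> cmat" where
  "minv (\<alpha>, \<beta>) = (cnj \<alpha>, - \<beta>)"

text \<open>
  The matrix preserves the real plane of vectors \<open>(v, cnj v)\<close>. Identifying this plane with
  \<open>\<complex>\<close> makes the conjugacy of \<open>SU(1,1)\<close> with \<open>SL(2,\<real>)\<close> explicit; the real linear action is
  the one on which ping-pong is played.
\<close>

fun act :: "cmat \<Rightarrow> complex \<Rightarrow> complex" where
  "act (\<alpha>, \<beta>) v = \<alpha> * v + \<beta> * cnj v"

lemma mmul_assoc: "mmul (mmul M N) P = mmul M (mmul N P)"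
  by (cases M; cases N; cases P) (simp add: algebra_simps)

lemma mmul_one [simp]: "mmul (1, 0) M = M" "mmul M (1, 0) = M"
  by (cases M; simp)+

lemma act_mmul: "act (mmul M N) v = act M (act N v)"
  by (cases M; cases N) (simp add: algebra_simps)

lemma su11_iff: "(\<alpha>, \<beta>) \<in> su11 \<longleftrightarrow> \<alpha> * cnj \<alpha> - \<beta> * cnj \<beta> = 1"
proof -
  have "\<alpha> * cnj \<alpha> - \<beta> * cnj \<beta> = of_real ((cmod \<alpha>)\<^sup>2 - (cmod \<beta>)\<^sup>2)"
    by (simp only: of_real_diff complex_norm_square)
  then show ?thesis
    unfolding su11_def by (metis (mono_tags, lifting) case_prod_conv mem_Collect_eq of_real_eq_1_iff)
qed

lemma su11_one: "(1, 0) \<in> su11"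
  by (simp add: su11_def)

lemma su11_mmul:
  assumes "M \<in> su11" "N \<in> su11"
  shows "mmul M N \<in> su11"
proof -
  obtain \<alpha> \<beta> \<gamma> \<delta> where MN: "M = (\<alpha>, \<beta>)" "N = (\<gamma>, \<delta>)" by (metis surj_pair)
  have "(\<alpha> * cnj \<alpha> - \<beta> * cnj \<beta>) * (\<gamma> * cnj \<gamma> - \<delta> * cnj \<delta>) = 1"
    using assms by (simp add: MN su11_iff)
  then show ?thesis
    by (simp add: MN su11_iff algebra_simps)
qed

lemma su11_minv: "M \<in> su11 \<Longrightarrow> minv M \<in> su11"
  by (cases M) (simp add: su11_def)

lemma mmul_minv:
  assumes "M \<in> su11"
  shows "mmul (minv M) M = (1, 0)" "mmul M (minv M) = (1, 0)"
  using assms by (cases M; simp add: su11_iff mult.commute)+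

text \<open>
  The matrix of the pair \<open>M\<close> has trace \<open>2 * Re (fst M)\<close>.
\<close>

lemma half_trace_cyclic: "Re (fst (mmul M N)) = Re (fst (mmul N M))"
  by (cases M; cases N) (simp add: algebra_simps)

section \<open>Trace and invariant cones\<close>

text \<open>
  The area form of the plane: it recovers determinants, traces and coordinates of real linear maps
  without a choice of basis.
\<close>

definition wedge :: "complex \<Rightarrow> complex \<Rightarrow> real" where
  "wedge v w = Im (cnj v * w)"

lemma wedge_act:
  assumes "M \<in> su11"
  shows "wedge (act M v) (act M w) = wedge v w"
proof -
  obtain \<alpha> \<beta> where M: "M = (\<alpha>, \<beta>)" by (metis surj_pair)
  have "wedge (act M v) (act M w) = ((cmod \<alpha>)\<^sup>2 - (cmod \<beta>)\<^sup>2) * wedge v w"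
    unfolding M wedge_def cmod_power2 by (simp add: algebra_simps power2_eq_square)
  then show ?thesis using assms by (simp add: M su11_def)
qed

lemma wedge_trace:
  "wedge (act M v) w + wedge v (act M w) = 2 * Re (fst M) * wedge v w"
  by (cases M) (simp add: wedge_def algebra_simps)

lemma act_add_scale: "act M (of_real x * v + of_real y * w) = of_real x * act M v + of_real y * act M w"
  by (cases M) (simp add: algebra_simps)

text \<open>
  A determinant one matrix that maps the closed positive quadrant into the union of the open positive
  quadrant and its negative has entries of one sign: its columns are images of the quadrant, and if they lay
  in opposite quadrants then some combination of them would have first entry \<open>0\<close>. So
  \<open>a * d = 1 + b * c > 1\<close>, and the arithmetic-geometric mean inequality bounds the trace.
\<close>

lemma trace_gt_2_of_positive:
  fixes a b c d :: real
  assumes det: "a * d - b * c = 1"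
    and pos: "\<And>x y. x \<ge> 0 \<Longrightarrow> y \<ge> 0 \<Longrightarrow> x \<noteq> 0 \<or> y \<noteq> 0 \<Longrightarrow> (a * x + b * y) * (c * x + d * y) > 0"
  shows "\<bar>a + d\<bar> > 2"
proof -
  have ac: "a * c > 0" and bd: "b * d > 0"
    using pos[of 1 0] pos[of 0 1] by auto
  have ab: "a * b > 0"
  proof (rule ccontr)
    assume "\<not> a * b > 0"
    moreover have "a \<noteq> 0" "b \<noteq> 0" using ac bd by auto
    ultimately have "a < 0 \<and> b > 0 \<or> a > 0 \<and> b < 0"
      by (meson linorder_neqE_linordered_idom mult_neg_neg mult_pos_pos)
    then have "a * \<bar>b\<bar> + b * \<bar>a\<bar> = 0"
      by (elim disjE conjE) simp_all
    with pos[of "\<bar>b\<bar>" "\<bar>a\<bar>"] \<open>a \<noteq> 0\<close> show False by simp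
  qed
  have "b * c > 0" using ac ab by (auto simp: zero_less_mult_iff)
  then have ad: "a * d > 1" using det by simp
  have "(a + d)\<^sup>2 = (a - d)\<^sup>2 + 4 * (a * d)" by (simp add: power2_eq_square algebra_simps)
  then have "(a + d)\<^sup>2 > 4" using ad zero_le_power2[of "a - d"] by linarith
  then show ?thesis using abs_le_square_iff[of "a + d" 2] by simp
qed

text \<open>
  The unit \<open>u\<close> names the generator that translates along the diameter of the disc from \<open>- u\<close> to \<open>u\<close>.
  Thus \<open>1\<close> and \<open>\<i>\<close> name the free generators \<open>a\<close> and \<open>b\<close>, and \<open>- u\<close> names the inverse of \<open>u\<close>.
\<close>

definition letters :: "complex set" where
  "letters = {1, -1, \<i>, -\<i>}"

text \<open>
  The double cone of \<open>v\<close> with \<open>cone_form u v \<ge> 0\<close> consists of the \<open>v\<close> for which the angle between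
  \<open>v\<^sup>2\<close> and \<open>u\<close> has cosine at least \<open>4/5\<close>. The cones of different letters are disjoint because
  \<open>4/5 > \<surd>2/2\<close>, and they are large enough for ping-pong because \<open>4/5 < \<surd>3/2\<close>, which is the value
  for the isometric circles of the generators. With \<open>4/5\<close> the boundary directions have rational
  coordinates.
\<close>

definition cone_form :: "complex \<Rightarrow> complex \<Rightarrow> real" where
  "cone_form u v = 5 * Re (v\<^sup>2 * cnj u) - 4 * (cmod v)\<^sup>2"

lemma cmod_letter: "u \<in> letters \<Longrightarrow> cmod u = 1"
  by (auto simp: letters_def)

lemma uminus_letter: "u \<in> letters \<Longrightarrow> - u \<in> letters"
  by (auto simp: letters_def)

text \<open>
  Membership in two cones would make two of the numbers \<open>\<plusminus>Re (v\<^sup>2)\<close> and \<open>\<plusminus>Im (v\<^sup>2)\<close> at least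
  \<open>4/5\<close> of \<open>|v\<^sup>2|\<close>. For opposite letters these numbers have opposite signs; otherwise their squares
  add up to more than \<open>|v\<^sup>2|\<^sup>2\<close>, since \<open>2 * (4/5)\<^sup>2 > 1\<close>.
\<close>

lemma cones_disjoint:
  assumes "u \<in> letters" "u' \<in> letters" "u \<noteq> u'" "v \<noteq> 0" "cone_form u v \<ge> 0"
  shows "cone_form u' v < 0"
proof (rule ccontr)
  assume "\<not> cone_form u' v < 0"
  then have 2: "5 * Re (v\<^sup>2 * cnj u') \<ge> 4 * (cmod v)\<^sup>2" by (simp add: cone_form_def)
  have 1: "5 * Re (v\<^sup>2 * cnj u) \<ge> 4 * (cmod v)\<^sup>2" using assms by (simp add: cone_form_def)
  define s t n where "s = Re (v\<^sup>2)" and "t = Im (v\<^sup>2)" and "n = (cmod v)\<^sup>2"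
  have n: "n > 0" using assms by (simp add: n_def)
  have nn: "n\<^sup>2 = s\<^sup>2 + t\<^sup>2" unfolding n_def s_def t_def
    by (metis cmod_power2 norm_power)
  have "False" if "5 * s \<ge> 4 * n \<or> 5 * s \<le> - (4 * n)" "5 * t \<ge> 4 * n \<or> 5 * t \<le> - (4 * n)"
  proof -
    have "\<bar>4 * n\<bar> \<le> \<bar>5 * s\<bar>" "\<bar>4 * n\<bar> \<le> \<bar>5 * t\<bar>" using that n by auto
    then have "(4 * n)\<^sup>2 \<le> (5 * s)\<^sup>2" "(4 * n)\<^sup>2 \<le> (5 * t)\<^sup>2" by (simp_all add: abs_le_square_iff)
    then have "32 * n\<^sup>2 \<le> 25 * n\<^sup>2" by (simp add: nn power_mult_distrib)
    then show False using n by simp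
  qed
  then show False using assms(1-3) 1 2 n
    by (auto simp: letters_def s_def[symmetric] t_def[symmetric] n_def[symmetric])
qed

section \<open>Ping-pong for the two generators\<close>

definition gen :: "complex \<Rightarrow> cmat" where
  "gen u = (2, of_real (sqrt 3) * u)"

lemma sqrt3: "sqrt 3 * sqrt 3 = (3::real)" "sqrt 3 > (173/100::real)" "sqrt 3 < (7/4::real)"
  by (simp, rule real_less_rsqrt, simp add: power2_eq_square, rule real_less_lsqrt)
     (simp_all add: power2_eq_square)

lemma of_real_sqrt3: "complex_of_real (sqrt 3) * complex_of_real (sqrt 3) = 3"
  by (metis of_real_mult of_real_numeral sqrt3(1))

lemma gen_su11: "u \<in> letters \<Longrightarrow> gen u \<in> su11"
  by (simp add: gen_def su11_def cmod_letter norm_mult power_mult_distrib)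

lemma gen_mult_uminus: "mmul (gen u) (gen (- u)) = (1, 0)" if "u \<in> letters"
  using mmul_minv(2)[OF gen_su11[OF that]] by (simp add: gen_def)

text \<open>
  In terms of \<open>n = |v|\<^sup>2\<close> and \<open>p = Re (v\<^sup>2 * cnj u)\<close> the generator acts linearly, by
  \<open>(n, p) \<mapsto> (7 * n + 4 * \<surd>3 * p, 7 * p + 4 * \<surd>3 * n)\<close>, so that the claim becomes one about two
  linear inequalities.
\<close>

lemma gen_ping_pong:
  assumes u: "u \<in> letters" and v: "v \<noteq> 0" and out: "cone_form (- u) v < 0"
  shows "cone_form u (act (gen u) v) > 0"
proof -
  define n q p where "n = (cmod v)\<^sup>2" and "q = v\<^sup>2 * cnj u" and "p = Re q"
  have n: "n > 0" using v by (simp add: n_def)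
  have uu: "u * cnj u = 1" using cmod_letter[OF u] by (simp add: complex_norm_square [symmetric])
  have vv: "v * cnj v = of_real n" by (simp only: n_def complex_norm_square)
  let ?s = "complex_of_real (sqrt 3)"
  have A: "act (gen u) v = 2 * v + ?s * u * cnj v" by (simp add: gen_def)
  have "(act (gen u) v)\<^sup>2 * cnj u =
      4 * q + 4 * ?s * (u * cnj u) * (v * cnj v) + (?s * ?s) * (u * cnj u) * cnj q"
    unfolding A q_def by (simp add: algebra_simps power2_eq_square)
  also have "\<dots> = 4 * q + of_real (4 * sqrt 3 * n) + 3 * cnj q"
    by (simp only: uu vv of_real_sqrt3) simp
  finally have 1: "Re ((act (gen u) v)\<^sup>2 * cnj u) = 7 * p + 4 * sqrt 3 * n"
    by (simp add: p_def)
  have "complex_of_real ((cmod (act (gen u) v))\<^sup>2) = act (gen u) v * cnj (act (gen u) v)"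
    by (simp only: complex_norm_square)
  also have "\<dots> = 4 * (v * cnj v) + (?s * ?s) * (u * cnj u) * (v * cnj v)
      + 2 * ?s * (q + cnj q)"
    unfolding A q_def by (simp add: algebra_simps power2_eq_square)
  also have "\<dots> = of_real (7 * n + 4 * sqrt 3 * p)"
    by (simp only: uu vv of_real_sqrt3 complex_add_cnj p_def[symmetric]) simp
  finally have 2: "(cmod (act (gen u) v))\<^sup>2 = 7 * n + 4 * sqrt 3 * p"
    by (simp only: of_real_eq_iff)
  \<comment> \<open>the goal is a positive multiple of \<open>5 * p + 4 * n\<close> plus a positive multiple of \<open>n\<close>\<close>
  have "5 * p > - (4 * n)" using out by (simp add: cone_form_def n_def p_def q_def)
  then have "(35 - 16 * sqrt 3) * (5 * p + 4 * n) > 0"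
    using sqrt3 by (intro mult_pos_pos) auto
  moreover have "(164 * sqrt 3 - 280) * n > 0" using sqrt3 n by (intro mult_pos_pos) auto
  ultimately show ?thesis
    unfolding cone_form_def 1 2 by (simp add: algebra_simps)
qed

text \<open>
  The cone is the union of a quadrant and its negative in the coordinates given by its two boundary
  lines. For \<open>u = 1\<close> these lines are spanned by \<open>3 \<plusminus> \<i>\<close>, and a square root of \<open>u\<close> rotates this case
  to the others.
\<close>

lemma cone_coordinates:
  assumes "u \<in> letters"
  obtains v w where "wedge v w \<noteq> 0"
    "\<And>x y. cone_form u (of_real x * v + of_real y * w) = 36 * (x * y)"
proof
  define z where "z = csqrt u"
  have zz: "z\<^sup>2 = u" by (simp add: z_def)
  have uu: "u * cnj u = 1" using cmod_letter[OF assms] by (simp add: complex_norm_square [symmetric])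
  have nz: "cmod z = 1" using cmod_letter[OF assms] zz
    by (metis norm_power power2_eq_1_iff norm_ge_zero abs_of_nonneg abs_minus_cancel abs_1 norm_minus_cancel)
  let ?v = "z * Complex 3 (-1)" and ?w = "z * Complex 3 1"
  have "cnj ?v * ?w = (z * cnj z) * (Complex 3 1)\<^sup>2"
    by (simp add: power2_eq_square complex_eq_iff algebra_simps)
  also have "\<dots> = (Complex 3 1)\<^sup>2" by (simp add: complex_norm_square [symmetric] nz)
  finally have "wedge ?v ?w = Im ((Complex 3 1)\<^sup>2)" by (simp only: wedge_def)
  then show "wedge ?v ?w \<noteq> 0" by (simp add: power2_eq_square)
  fix x y :: real
  let ?e = "of_real x * ?v + of_real y * ?w"
  have e: "?e = z * Complex (3 * (x + y)) (y - x)"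
    by (simp add: complex_eq_iff algebra_simps)
  have "?e\<^sup>2 * cnj u = (u * cnj u) * (Complex (3 * (x + y)) (y - x))\<^sup>2"
    unfolding e by (simp add: power_mult_distrib zz)
  then have 1: "Re (?e\<^sup>2 * cnj u) = 9 * (x + y)\<^sup>2 - (y - x)\<^sup>2"
    by (simp add: uu power2_eq_square algebra_simps)
  have 2: "(cmod ?e)\<^sup>2 = 9 * (x + y)\<^sup>2 + (y - x)\<^sup>2"
    unfolding e norm_mult nz 
    by (simp only: mult_1 cmod_power2 complex.sel) (simp add: power2_eq_square algebra_simps)
  show "cone_form u ?e = 36 * (x * y)"
    unfolding cone_form_def 1 2 by (simp add: power2_eq_square algebra_simps)
qed

text \<open>
  Perron-Frobenius in dimension two: in the coordinates of the cone, \<open>M\<close> satisfies the assumptions of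
  \<open>trace_gt_2_of_positive\<close>.
\<close>

lemma half_trace_gt_1_of_cone:
  assumes M: "M \<in> su11" and u: "u \<in> letters"
    and cone: "\<And>v. v \<noteq> 0 \<Longrightarrow> cone_form u v \<ge> 0 \<Longrightarrow> cone_form u (act M v) > 0"
  shows "\<bar>Re (fst M)\<bar> > 1"
proof -
  obtain v w where vw: "wedge v w \<noteq> 0"
    and form: "\<And>x y. cone_form u (of_real x * v + of_real y * w) = 36 * (x * y)"
    using cone_coordinates[OF u] by blast
  define D where "D = wedge v w"
  have D: "D \<noteq> 0" using vw D_def by simp
  have expand: "e = of_real (wedge e w / D) * v + of_real (wedge v e / D) * w" for e
  proof -
    have "of_real D * e = of_real (wedge e w) * v + of_real (wedge v e) * w"
      unfolding D_def wedge_def by (simp add: complex_eq_iff algebra_simps)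
    then show ?thesis using D by (simp add: field_simps)
  qed
  define a c b d where "a = wedge (act M v) w / D" and "c = wedge v (act M v) / D"
    and "b = wedge (act M w) w / D" and "d = wedge v (act M w) / D"
  have Mv: "act M v = of_real a * v + of_real c * w"
    unfolding a_def c_def by (rule expand)
  have Mw: "act M w = of_real b * v + of_real d * w"
    unfolding b_def d_def by (rule expand)
  have "D * (a * d - b * c) = wedge (act M v) (act M w)"
    unfolding Mv Mw D_def by (simp add: wedge_def algebra_simps)
  also have "\<dots> = D" by (simp add: wedge_act[OF M] D_def)
  finally have det: "a * d - b * c = 1" using D by simp
  have tr: "a + d = 2 * Re (fst M)"
    using wedge_trace[of M v w] D unfolding a_def d_def D_def[symmetric]
    by (simp add: add_divide_distrib [symmetric])
  have "(a * x + b * y) * (c * x + d * y) > 0"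
    if xy: "x \<ge> 0" "y \<ge> 0" "x \<noteq> 0 \<or> y \<noteq> 0" for x y
  proof -
    let ?e = "of_real x * v + of_real y * w"
    have wedge_e: "wedge ?e w = x * D" "wedge v ?e = y * D"
      by (simp_all add: D_def wedge_def algebra_simps)
    have "?e \<noteq> 0"
    proof
      assume "?e = 0"
      then have "x * D = 0" "y * D = 0" using wedge_e by (simp_all add: wedge_def)
      then show False using xy D by simp
    qed
    moreover have "cone_form u ?e \<ge> 0" using xy by (simp add: form)
    ultimately have "cone_form u (act M ?e) > 0" by (rule cone)
    moreover have "act M ?e = of_real (a * x + b * y) * v + of_real (c * x + d * y) * w"
      unfolding act_add_scale Mv Mw by (simp add: algebra_simps)
    ultimately show ?thesis by (simp only: form zero_less_mult_iff) simp
  qed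
  then have "\<bar>a + d\<bar> > 2" by (rule trace_gt_2_of_positive[OF det])
  then show ?thesis by (simp add: tr)
qed

text \<open>
  Words are lists of letters. They are not required to be reduced, so that products of words are
  concatenations.
\<close>

definition word_mat :: "complex list \<Rightarrow> cmat" where
  "word_mat w = foldr (\<lambda>u. mmul (gen u)) w (1, 0)"

definition word_inv :: "complex list \<Rightarrow> complex list" where
  "word_inv w = rev (map uminus w)"

text \<open>
  The exponent sum of \<open>a\<close>, since \<open>Re u\<close> is \<open>1\<close> for \<open>a\<close>, \<open>-1\<close> for its inverse and \<open>0\<close> for the
  other two letters.
\<close>

definition height :: "complex list \<Rightarrow> real" where
  "height w = (\<Sum>u\<leftarrow>w. Re u)"

lemma word_mat_Nil [simp]: "word_mat [] = (1, 0)" and word_mat_Cons [simp]: "word_mat (u # w) = mmul (gen u) (word_mat w)"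
  by (simp_all add: word_mat_def)

lemma word_mat_append: "word_mat (w @ w') = mmul (word_mat w) (word_mat w')"
  by (induction w) (simp_all add: mmul_assoc)

lemma word_mat_su11: "w \<in> lists letters \<Longrightarrow> word_mat w \<in> su11"
  by (induction w) (auto intro: su11_one su11_mmul gen_su11)

lemma word_inv_letters: "w \<in> lists letters \<Longrightarrow> word_inv w \<in> lists letters"
  by (auto simp: word_inv_def uminus_letter lists_eq_set)

lemma word_mat_word_inv: "w \<in> lists letters \<Longrightarrow> word_mat (word_inv w) = minv (word_mat w)"
proof (induction w)
  case (Cons u w)
  have "mmul (word_mat (word_inv w)) (gen (- u)) = minv (mmul (gen u) (word_mat w))"
    using Cons by (cases "word_mat w") (simp add: gen_def)
  then show ?case using Cons by (simp add: word_inv_def word_mat_append)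
qed (simp add: word_inv_def)

lemma height_simps [simp]: "height [] = 0" "height (u # w) = Re u + height w"
  "height (w @ w') = height w + height w'"
  by (simp_all add: height_def)

lemma height_word_inv [simp]: "height (word_inv w) = - height w"
  by (induction w) (simp_all add: word_inv_def)

text \<open>
  After each letter the vector is in the cone of that letter. By disjointness it is outside the cone
  that the next letter has to avoid, which is the one of the inverse of the next letter.
\<close>

lemma reduced_word_ping_pong:
  assumes "w \<in> lists letters" "w \<noteq> []" "successively (\<lambda>u u'. u' \<noteq> - u) w"
    and "v \<noteq> 0" "cone_form (- last w) v < 0"
  shows "cone_form (hd w) (act (word_mat w) v) > 0 \<and> act (word_mat w) v \<noteq> 0"
  using assms
proof (induction w)
  case (Cons u w)
  have nz: "cone_form u e > 0 \<Longrightarrow> e \<noteq> 0" for e by (auto simp: cone_form_def)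
  have u: "u \<in> letters" using Cons by simp
  show ?case
  proof (cases "w = []")
    case True
    then show ?thesis using Cons.prems gen_ping_pong[OF u, of v] nz by auto
  next
    case False
    let ?e = "act (word_mat w) v"
    have e: "cone_form (hd w) ?e > 0 \<and> ?e \<noteq> 0"
      using Cons False by (auto simp: successively_Cons)
    have "hd w \<in> letters" using Cons.hyps(2) hd_in_set[OF False] by (simp add: in_lists_conv_set)
    moreover have "hd w \<noteq> - u" using Cons.prems False by (auto simp: successively_Cons)
    ultimately have "cone_form (- u) ?e < 0"
      using e by (intro cones_disjoint[of "hd w" "- u"]) (auto simp: u uminus_letter)
    then have "cone_form u (act (gen u) ?e) > 0" using e u by (intro gen_ping_pong) auto
    then show ?thesis using nz by (auto simp: act_mmul)
  qed
qed simp

lemma not_reduced_split: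
  assumes "\<not> successively (\<lambda>u u'. u' \<noteq> - u) w"
  obtains x u y where "w = x @ [u, - u] @ y"
  using assms
proof (induction w arbitrary: thesis)
  case (Cons a w)
  show ?case
  proof (cases "successively (\<lambda>u u'. u' \<noteq> - u) w")
    case True
    then have "w \<noteq> []" "hd w = - a" using Cons.prems(2) by (auto simp: successively_Cons)
    then have "a # w = [] @ [a, - a] @ tl w" by (cases w) auto
    then show ?thesis by (rule Cons.prems(1))
  next
    case False
    then obtain x u y where "w = x @ [u, - u] @ y" using Cons.IH by blast
    then have "a # w = (a # x) @ [u, - u] @ y" by simp
    then show ?thesis by (rule Cons.prems(1))
  qed
qed simp

text \<open>
  Cancellation of adjacent inverse letters and conjugation by the first letter preserve the trace, the
  height and the property of being the identity matrix. They shorten the word until it is empty or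
  cyclically reduced. In the latter case the cone of the first letter avoids the cone of the inverse
  of the last letter, hence is mapped into its own interior.
\<close>

lemma word_trivial_or_hyperbolic:
  assumes "w \<in> lists letters"
  shows "word_mat w = (1, 0) \<and> height w = 0 \<or> \<bar>Re (fst (word_mat w))\<bar> > 1"
  using assms
proof (induction "length w" arbitrary: w rule: less_induct)
  case less
  consider (nil) "w = []" | (cancel) "\<not> successively (\<lambda>u u'. u' \<noteq> - u) w"
    | (conj) "w \<noteq> []" "last w = - hd w"
    | (cyc) "w \<noteq> []" "last w \<noteq> - hd w" "successively (\<lambda>u u'. u' \<noteq> - u) w"
    by blast
  then show ?case
  proof cases
    case cancel
    then obtain x u y where w: "w = x @ [u, - u] @ y" by (rule not_reduced_split)
    have u: "u \<in> letters" using less.prems w by simp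
    have "word_mat w = mmul (word_mat x) (mmul (mmul (gen u) (gen (- u))) (word_mat y))"
      by (simp add: w word_mat_append mmul_assoc)
    then have "word_mat w = word_mat (x @ y)" by (simp add: gen_mult_uminus[OF u] word_mat_append)
    moreover have "height w = height (x @ y)" by (simp add: w)
    ultimately show ?thesis using less.hyps[of "x @ y"] less.prems w by simp
  next
    case conj
    define u where "u = hd w"
    have u: "u \<in> letters" using less.prems conj by (cases w) (auto simp: u_def)
    have "u \<noteq> - u" using u by (auto simp: letters_def)
    then obtain x where w: "w = u # x @ [- u]"
      using conj unfolding u_def
      by (cases w; cases "tl w" rule: rev_cases) auto
    have x: "word_mat x = (1, 0) \<and> height x = 0 \<or> \<bar>Re (fst (word_mat x))\<bar> > 1"
      using less.hyps[of x] less.prems w by simp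
    have W: "word_mat w = mmul (mmul (gen u) (word_mat x)) (gen (- u))"
      by (simp add: w word_mat_append mmul_assoc)
    have "Re (fst (word_mat w)) = Re (fst (mmul (mmul (gen (- u)) (gen u)) (word_mat x)))"
      unfolding W by (subst half_trace_cyclic) (simp add: mmul_assoc)
    also have "mmul (gen (- u)) (gen u) = (1, 0)"
      using gen_mult_uminus[OF uminus_letter[OF u]] by simp
    finally have "Re (fst (word_mat w)) = Re (fst (word_mat x))" by simp
    moreover have "word_mat w = (1, 0)" if "word_mat x = (1, 0)"
      unfolding W that by (simp add: gen_mult_uminus[OF u])
    ultimately show ?thesis using x w by auto
  next
    case cyc
    have hl: "hd w \<in> letters" "last w \<in> letters" using less.prems cyc by auto
    have "\<bar>Re (fst (word_mat w))\<bar> > 1"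
    proof (rule half_trace_gt_1_of_cone[OF word_mat_su11[OF less.prems] hl(1)])
      fix v assume v: "v \<noteq> 0" "cone_form (hd w) v \<ge> 0"
      have "cone_form (- last w) v < 0"
        using v hl cyc by (intro cones_disjoint[of "hd w"]) (auto simp: uminus_letter)
      then show "cone_form (hd w) (act (word_mat w) v) > 0"
        using reduced_word_ping_pong[of w v] less.prems cyc v by blast
    qed
    then show ?thesis ..
  qed simp
qed

section \<open>Isometries of the disc\<close>

fun denom :: "cmat \<Rightarrow> complex \<Rightarrow> complex" where
  "denom (\<alpha>, \<beta>) z = cnj \<beta> * z + cnj \<alpha>"

fun mob :: "cmat \<Rightarrow> complex \<Rightarrow> complex" where
  "mob (\<alpha>, \<beta>) z = (\<alpha> * z + \<beta>) / (cnj \<beta> * z + cnj \<alpha>)"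

definition disc_iso :: "cmat \<Rightarrow> complex \<Rightarrow> complex" where
  "disc_iso M = restrict (mob M) hplane"

lemma su11_norm_less: "(\<alpha>, \<beta>) \<in> su11 \<Longrightarrow> cmod \<beta> < cmod \<alpha>"
  using power2_less_imp_less[of "cmod \<beta>" "cmod \<alpha>"] by (simp add: su11_def)

lemma denom_nonzero:
  assumes "M \<in> su11" "cmod z \<le> 1"
  shows "denom M z \<noteq> 0"
proof
  obtain \<alpha> \<beta> where M: "M = (\<alpha>, \<beta>)" by (metis surj_pair)
  assume "denom M z = 0"
  then have "cnj \<beta> * z = - cnj \<alpha>" by (simp add: M eq_neg_iff_add_eq_0)
  then have "cmod \<beta> * cmod z = cmod \<alpha>" by (metis complex_mod_cnj norm_minus_cancel norm_mult)
  moreover have "cmod \<beta> * cmod z \<le> cmod \<beta>" using assms(2) by (simp add: mult_left_le)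
  ultimately show False using su11_norm_less assms(1) M by fastforce
qed

text \<open>
  The domain is the closed disc, not only the open one, because the same identity is needed for fixed
  points on the circle.
\<close>

lemma mob_mmul:
  assumes "M \<in> su11" "N \<in> su11" "cmod z \<le> 1"
  shows "mob (mmul M N) z = mob M (mob N z)"
proof -
  obtain \<alpha> \<beta> \<gamma> \<delta> where MN: "M = (\<alpha>, \<beta>)" "N = (\<gamma>, \<delta>)" by (metis surj_pair)
  have d: "cnj \<delta> * z + cnj \<gamma> \<noteq> 0" using denom_nonzero[OF assms(2,3)] by (simp add: MN)
  have 1: "mob M (mob N z) = ((\<alpha> * mob N z + \<beta>) * (cnj \<delta> * z + cnj \<gamma>)) /
      ((cnj \<beta> * mob N z + cnj \<alpha>) * (cnj \<delta> * z + cnj \<gamma>))"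
    using d by (simp add: MN(1))
  have "mob N z * (cnj \<delta> * z + cnj \<gamma>) = \<gamma> * z + \<delta>" using d by (simp add: MN(2))
  then have 2: "(\<alpha> * mob N z + \<beta>) * (cnj \<delta> * z + cnj \<gamma>) = \<alpha> * (\<gamma> * z + \<delta>) + \<beta> * (cnj \<delta> * z + cnj \<gamma>)"
    "(cnj \<beta> * mob N z + cnj \<alpha>) * (cnj \<delta> * z + cnj \<gamma>) = cnj \<beta> * (\<gamma> * z + \<delta>) + cnj \<alpha> * (cnj \<delta> * z + cnj \<gamma>)"
    by (metis distrib_right mult.assoc)+
  show ?thesis
    unfolding 1 2 by (simp add: MN algebra_simps)
qed

lemma mob_one [simp]: "mob (1, 0) z = z"
  by simp

text \<open>
  The determinant condition in the form in which it controls the distance to the circle. It yields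
  invariance of the disc and of the circle, one factor of the invariance of the hyperbolic distance,
  and the bound on matrix entries behind discreteness.
\<close>

lemma mob_boundary_identity:
  assumes "M \<in> su11" "cmod z \<le> 1"
  shows "(1 - (cmod (mob M z))\<^sup>2) * (cmod (denom M z))\<^sup>2 = 1 - (cmod z)\<^sup>2"
proof -
  obtain \<alpha> \<beta> where M: "M = (\<alpha>, \<beta>)" by (metis surj_pair)
  have "cmod (mob M z) * cmod (denom M z) = cmod (\<alpha> * z + \<beta>)"
    using denom_nonzero[OF assms] by (simp add: M norm_divide)
  then have "(1 - (cmod (mob M z))\<^sup>2) * (cmod (denom M z))\<^sup>2 =
      (cmod (denom M z))\<^sup>2 - (cmod (\<alpha> * z + \<beta>))\<^sup>2"
    by (simp add: left_diff_distrib flip: power_mult_distrib)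
  also have "\<dots> = ((cmod \<alpha>)\<^sup>2 - (cmod \<beta>)\<^sup>2) * (1 - (cmod z)\<^sup>2)"
    unfolding M denom.simps cmod_power2 by (simp add: power2_eq_square algebra_simps)
  finally show ?thesis using assms by (simp add: M su11_def)
qed

lemma mob_hplane:
  assumes "M \<in> su11" "z \<in> hplane"
  shows "mob M z \<in> hplane"
proof -
  have z: "cmod z < 1" using assms by (simp add: hplane_def)
  then have "(cmod z)\<^sup>2 < 1" by (simp add: abs_square_less_1)
  then have "(1 - (cmod (mob M z))\<^sup>2) * (cmod (denom M z))\<^sup>2 > 0"
    using mob_boundary_identity[OF assms(1), of z] z by simp
  then have "(cmod (mob M z))\<^sup>2 < 1" by (simp add: zero_less_mult_iff)
  then show ?thesis by (simp add: hplane_def abs_square_less_1)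
qed

lemma mob_diff:
  assumes "M \<in> su11" "cmod z \<le> 1" "cmod w \<le> 1"
  shows "(mob M z - mob M w) * (denom M z * denom M w) = z - w"
proof -
  obtain \<alpha> \<beta> where M: "M = (\<alpha>, \<beta>)" by (metis surj_pair)
  have "mob M z * denom M z = \<alpha> * z + \<beta>" "mob M w * denom M w = \<alpha> * w + \<beta>"
    using denom_nonzero[OF assms(1,2)] denom_nonzero[OF assms(1,3)] by (simp_all add: M)
  then have "(mob M z - mob M w) * (denom M z * denom M w) =
      (\<alpha> * z + \<beta>) * denom M w - (\<alpha> * w + \<beta>) * denom M z"
    by (simp add: left_diff_distrib flip: mult.assoc)
  also have "\<dots> = (\<alpha> * cnj \<alpha> - \<beta> * cnj \<beta>) * (z - w)"
    by (simp add: M algebra_simps)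
  also have "\<dots> = z - w" using assms(1) by (simp add: M su11_iff)
  finally show ?thesis .
qed

lemma hdist_mob:
  assumes "M \<in> su11" "z \<in> hplane" "w \<in> hplane"
  shows "hdist (mob M z) (mob M w) = hdist z w"
proof -
  have zw: "cmod z \<le> 1" "cmod w \<le> 1" using assms by (simp_all add: hplane_def)
  let ?c = "(cmod (denom M z))\<^sup>2 * (cmod (denom M w))\<^sup>2"
  have "?c \<noteq> 0" using denom_nonzero[OF assms(1)] zw by simp
  then have "(cmod (mob M z - mob M w))\<^sup>2 / ((1 - (cmod (mob M z))\<^sup>2) * (1 - (cmod (mob M w))\<^sup>2)) =
     ((cmod (mob M z - mob M w))\<^sup>2 * ?c) / (((1 - (cmod (mob M z))\<^sup>2) * (1 - (cmod (mob M w))\<^sup>2)) * ?c)"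
    by simp
  also have "(cmod (mob M z - mob M w))\<^sup>2 * ?c = (cmod (z - w))\<^sup>2"
    using arg_cong[OF mob_diff[OF assms(1) zw], of "\<lambda>x. (cmod x)\<^sup>2"]
    by (simp add: norm_mult power_mult_distrib)
  also have "((1 - (cmod (mob M z))\<^sup>2) * (1 - (cmod (mob M w))\<^sup>2)) * ?c =
      (1 - (cmod z)\<^sup>2) * (1 - (cmod w)\<^sup>2)"
    unfolding mob_boundary_identity[OF assms(1) zw(1), symmetric]
      mob_boundary_identity[OF assms(1) zw(2), symmetric]
    by (simp only: mult_ac)
  finally show ?thesis unfolding hdist_def by (metis times_divide_eq_right)
qed

lemma mob_has_field_derivative:
  assumes "M \<in> su11" "cmod z \<le> 1"
  shows "(mob M has_field_derivative 1 / (denom M z)\<^sup>2) (at z)"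
proof -
  obtain \<alpha> \<beta> where M: "M = (\<alpha>, \<beta>)" by (metis surj_pair)
  have d: "cnj \<beta> * z + cnj \<alpha> \<noteq> 0" using denom_nonzero[OF assms] by (simp add: M)
  have "(\<alpha> * (cnj \<beta> * z + cnj \<alpha>) - (\<alpha> * z + \<beta>) * cnj \<beta>) = 1"
    using assms(1) by (simp add: M su11_iff algebra_simps)
  then have "((\<lambda>z. (\<alpha> * z + \<beta>) / (cnj \<beta> * z + cnj \<alpha>)) has_field_derivative 1 / (denom M z)\<^sup>2) (at z)"
    using d by (auto intro!: derivative_eq_intros simp: M power2_eq_square)
  moreover have "mob M = (\<lambda>z. (\<alpha> * z + \<beta>) / (cnj \<beta> * z + cnj \<alpha>))"
    by (simp add: M fun_eq_iff)
  ultimately show ?thesis by simp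
qed

lemma disc_iso_bij: 
  assumes "M \<in> su11"
  shows "disc_iso M \<in> Bij hplane"
proof -
  have le: "cmod z \<le> 1" if "z \<in> hplane" for z using that by (simp add: hplane_def)
  have "bij_betw (mob M) hplane hplane"
  proof (rule bij_betw_byWitness[where f' = "mob (minv M)"])
    show "\<forall>z\<in>hplane. mob (minv M) (mob M z) = z"
      using mob_mmul[OF su11_minv[OF assms] assms] le by (simp add: mmul_minv[OF assms])
    show "\<forall>z\<in>hplane. mob M (mob (minv M) z) = z"
      using mob_mmul[OF assms su11_minv[OF assms]] le by (simp add: mmul_minv[OF assms])
  qed (auto simp del: mob.simps intro: mob_hplane assms su11_minv)
  then show ?thesis
    by (simp add: Bij_def disc_iso_def bij_betw_cong[of hplane "restrict (mob M) hplane" "mob M"])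
qed

lemma disc_iso_isom_plus:
  assumes "M \<in> su11"
  shows "disc_iso M \<in> carrier isom_plus"
proof -
  have "orientation_preserving (disc_iso M)"
    unfolding orientation_preserving_def
  proof
    fix z assume z: "z \<in> hplane"
    define c where "c = 1 / (denom M z)\<^sup>2"
    have nz: "denom M z \<noteq> 0" using denom_nonzero[OF assms] z by (simp add: hplane_def)
    have "(mob M has_derivative (*) c) (at z)"
      unfolding c_def using mob_has_field_derivative[OF assms] z
      by (simp add: has_field_derivative_def hplane_def)
    then have "(disc_iso M has_derivative (*) c) (at z)"
      by (rule has_derivative_transform_within_open[of _ _ _ _ hplane])
         (use z in \<open>auto simp: hplane_def disc_iso_def\<close>)
    moreover have "Im (cnj (c * 1) * (c * \<i>)) = (cmod c)\<^sup>2"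
      by (simp only: cmod_power2) (simp add: power2_eq_square)
    moreover have "(cmod c)\<^sup>2 > 0" using nz by (simp add: c_def)
    ultimately show "\<exists>f'. (disc_iso M has_derivative f') (at z) \<and> 0 < Im (cnj (f' 1) * f' \<i>)"
      by (intro exI[of _ "(*) c"]) (simp only:)
  qed
  then show ?thesis
    using disc_iso_bij[OF assms] hdist_mob[OF assms] by (simp add: isom_plus_def disc_iso_def)
qed

lemma isom_plus_mult: "f \<in> Bij hplane \<Longrightarrow> g \<in> Bij hplane \<Longrightarrow> f \<otimes>\<^bsub>isom_plus\<^esub> g = compose hplane f g"
  by (simp add: isom_plus_def BijGroup_def)

lemma isom_plus_one: "\<one>\<^bsub>isom_plus\<^esub> = (\<lambda>z\<in>hplane. z)"
  by (simp add: isom_plus_def BijGroup_def)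

lemma disc_iso_one: "disc_iso (1, 0) = \<one>\<^bsub>isom_plus\<^esub>"
  by (simp add: disc_iso_def isom_plus_one fun_eq_iff restrict_def)

lemma disc_iso_mmul:
  assumes "M \<in> su11" "N \<in> su11"
  shows "disc_iso (mmul M N) = disc_iso M \<otimes>\<^bsub>isom_plus\<^esub> disc_iso N"
proof -
  have "mob (mmul M N) z = mob M (mob N z)" if "z \<in> hplane" for z
    using mob_mmul[OF assms] that by (simp add: hplane_def)
  then show ?thesis
    using mob_hplane[OF assms(2)]
    by (simp add: isom_plus_mult disc_iso_bij assms) (auto simp: disc_iso_def compose_def fun_eq_iff)
qed

lemma disc_iso_minv:
  assumes "M \<in> su11"
  shows "disc_iso (minv M) = inv\<^bsub>isom_plus\<^esub> (disc_iso M)"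
  using group.inv_equality[OF group_isom_plus, of "disc_iso (minv M)" "disc_iso M"]
  by (simp add: disc_iso_mmul[symmetric] disc_iso_isom_plus su11_minv assms mmul_minv disc_iso_one)

text \<open>
  The map is analytic near the closed disc, so its continuous extension to the circle is given by the
  same formula.
\<close>

lemma fixed_points_inf_disc_iso:
  assumes "M \<in> su11"
  shows "fixed_points_inf (disc_iso M) = {\<xi>. cmod \<xi> = 1 \<and> mob M \<xi> = \<xi>}"
proof -
  have "(disc_iso M \<longlongrightarrow> \<xi>) (at \<xi> within hplane) \<longleftrightarrow> mob M \<xi> = \<xi>" if \<xi>: "cmod \<xi> = 1" for \<xi>
  proof -
    have "isCont (mob M) \<xi>"
      using mob_has_field_derivative[OF assms, of \<xi>] \<xi> by (auto intro: DERIV_isCont)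
    then have "(mob M \<longlongrightarrow> mob M \<xi>) (at \<xi> within hplane)"
      by (simp add: isCont_def tendsto_within_subset[of _ _ _ UNIV])
    then have lim: "(disc_iso M \<longlongrightarrow> mob M \<xi>) (at \<xi> within hplane)"
      by (rule Lim_transform_eventually) (auto simp: eventually_at_filter disc_iso_def)
    have "\<xi> islimpt hplane" using \<xi> by (simp add: hplane_def islimpt_ball)
    then have "at \<xi> within hplane \<noteq> bot" by (simp add: trivial_limit_within)
    then show ?thesis using lim tendsto_unique by metis
  qed
  then show ?thesis by (auto simp: fixed_points_inf_def circle_inf_def)
qed

text \<open>
  Fixed points are the roots of \<open>cnj \<beta> * z\<^sup>2 + (cnj \<alpha> - \<alpha>) * z - \<beta>\<close>. Completing the square turns
  this into \<open>(cnj \<beta> * z - \<i> * Im \<alpha>)\<^sup>2 = D\<^sup>2\<close> with \<open>D\<close> as below, because \<open>|\<beta>|\<^sup>2 = D\<^sup>2 + (Im \<alpha>)\<^sup>2\<close>; the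
  same equation puts both roots on the circle.
\<close>

lemma hyperbolic_fixed_points:
  assumes M: "(\<alpha>, \<beta>) \<in> su11" and tr: "\<bar>Re \<alpha>\<bar> > 1"
  defines "D \<equiv> sqrt ((Re \<alpha>)\<^sup>2 - 1)"
  shows "cmod z \<le> 1 \<Longrightarrow> mob (\<alpha>, \<beta>) z = z \<longleftrightarrow>
      z = (of_real D + \<i> * of_real (Im \<alpha>)) / cnj \<beta> \<or> z = (- of_real D + \<i> * of_real (Im \<alpha>)) / cnj \<beta>"
    and "cmod ((of_real D + \<i> * of_real (Im \<alpha>)) / cnj \<beta>) = 1"
    and "cmod ((- of_real D + \<i> * of_real (Im \<alpha>)) / cnj \<beta>) = 1"
    and "D > 0" and "\<beta> \<noteq> 0"
proof -
  have "(Re \<alpha>)\<^sup>2 > 1" using tr by (metis abs_square_le_1 not_le)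
  then show D: "D > 0" by (simp add: D_def)
  have DD: "D\<^sup>2 = (Re \<alpha>)\<^sup>2 - 1" using D by (simp add: D_def)
  have b: "(cmod \<beta>)\<^sup>2 = D\<^sup>2 + (Im \<alpha>)\<^sup>2"
    using M by (simp add: su11_def cmod_power2 DD)
  then show b0: "\<beta> \<noteq> 0" using D by (auto simp: sum_power2_eq_zero_iff)
  have "cmod (of_real s * of_real D + \<i> * of_real (Im \<alpha>)) = cmod \<beta>" if "s\<^sup>2 = 1" for s :: real
  proof -
    have "(cmod (of_real s * of_real D + \<i> * of_real (Im \<alpha>)))\<^sup>2 = (cmod \<beta>)\<^sup>2"
      unfolding b using that by (simp add: cmod_power2 power_mult_distrib)
    then show ?thesis by simp
  qed
  from this[of 1] this[of "-1"]
  show "cmod ((of_real D + \<i> * of_real (Im \<alpha>)) / cnj \<beta>) = 1"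
     "cmod ((- of_real D + \<i> * of_real (Im \<alpha>)) / cnj \<beta>) = 1"
    using b0 by (simp_all add: norm_divide)
  assume z: "cmod z \<le> 1"
  define t where "t = cnj \<beta> * z - \<i> * of_real (Im \<alpha>)"
  have d: "cnj \<beta> * z + cnj \<alpha> \<noteq> 0" using denom_nonzero[OF M z] by simp
  have bb: "\<beta> * cnj \<beta> = of_real (D\<^sup>2 + (Im \<alpha>)\<^sup>2)" by (simp only: b[symmetric] complex_norm_square)
  have aa: "\<alpha> = of_real (Re \<alpha>) + \<i> * of_real (Im \<alpha>)" "cnj \<alpha> = of_real (Re \<alpha>) - \<i> * of_real (Im \<alpha>)"
    by (simp_all add: complex_eq_iff)
  have "mob (\<alpha>, \<beta>) z = z \<longleftrightarrow> cnj \<beta> * (\<alpha> * z + \<beta>) = cnj \<beta> * (z * (cnj \<beta> * z + cnj \<alpha>))"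
    using d b0 by (simp add: divide_eq_eq)
  also have "\<dots> \<longleftrightarrow> t\<^sup>2 = (of_real D)\<^sup>2"
  proof -
    have "cnj \<beta> * (z * (cnj \<beta> * z + cnj \<alpha>)) - cnj \<beta> * (\<alpha> * z + \<beta>) =
        (cnj \<beta> * z)\<^sup>2 + (cnj \<alpha> - \<alpha>) * (cnj \<beta> * z) - \<beta> * cnj \<beta>"
      by (simp add: power2_eq_square algebra_simps)
    also have "\<dots> = t\<^sup>2 - (of_real D)\<^sup>2"
      unfolding bb t_def by (subst aa(1), subst aa(2)) (simp add: power2_eq_square algebra_simps)
    finally show ?thesis by (metis eq_iff_diff_eq_0)
  qed
  also have "\<dots> \<longleftrightarrow> t = of_real D \<or> t = - of_real D" by (rule power2_eq_iff)
  also have "\<dots> \<longleftrightarrow> z = (of_real D + \<i> * of_real (Im \<alpha>)) / cnj \<beta> \<or> z = (- of_real D + \<i> * of_real (Im \<alpha>)) / cnj \<beta>"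
    using b0 by (auto simp: t_def eq_divide_eq algebra_simps)
  finally show "mob (\<alpha>, \<beta>) z = z \<longleftrightarrow> z = (of_real D + \<i> * of_real (Im \<alpha>)) / cnj \<beta> \<or> z = (- of_real D + \<i> * of_real (Im \<alpha>)) / cnj \<beta>" .
qed

lemma loxodromic_disc_iso:
  assumes M: "M \<in> su11" and tr: "\<bar>Re (fst M)\<bar> > 1"
  shows "loxodromic (disc_iso M)"
proof -
  obtain \<alpha> \<beta> where M': "M = (\<alpha>, \<beta>)" by (metis surj_pair)
  define D where "D = sqrt ((Re \<alpha>)\<^sup>2 - 1)"
  let ?p = "(of_real D + \<i> * of_real (Im \<alpha>)) / cnj \<beta>" and ?q = "(- of_real D + \<i> * of_real (Im \<alpha>)) / cnj \<beta>"
  note * = hyperbolic_fixed_points[of \<alpha> \<beta>, folded D_def]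
  have fp: "mob M z = z \<longleftrightarrow> z = ?p \<or> z = ?q" if "cmod z \<le> 1" for z
    using *(1) assms that by (simp add: M')
  have pq: "cmod ?p = 1" "cmod ?q = 1" "D > 0" "\<beta> \<noteq> 0"
    using *(2-5) assms by (simp_all add: M')
  have "fixed_points_inf (disc_iso M) = {?p, ?q}"
    using fp pq(1,2) by (auto simp: fixed_points_inf_disc_iso[OF M] simp del: mob.simps)
  moreover have "?p \<noteq> ?q" using pq(3,4) by simp
  ultimately have "card (fixed_points_inf (disc_iso M)) = 2" by simp
  moreover have "disc_iso M z \<noteq> z" if "z \<in> hplane" for z
    using that fp[of z] pq(1,2) by (auto simp: disc_iso_def hplane_def)
  ultimately show ?thesis
    using disc_iso_isom_plus[OF M] by (simp add: loxodromic_def)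
qed

section \<open>Discreteness from integral entries\<close>

definition gaussian :: "complex set" where
  "gaussian = {z. Re z \<in> \<int> \<and> Im z \<in> \<int>}"

text \<open>
  The factor \<open>\<surd>3\<close> enters squared into the diagonal entries of products, which is why these matrices
  are closed under multiplication.
\<close>

definition integral_mats :: "cmat set" where
  "integral_mats = su11 \<inter> {(\<alpha>, of_real (sqrt 3) * \<beta>) | \<alpha> \<beta>. \<alpha> \<in> gaussian \<and> \<beta> \<in> gaussian}"

lemma gaussian_closed:
  "x \<in> gaussian \<Longrightarrow> y \<in> gaussian \<Longrightarrow> x + y \<in> gaussian"
  "x \<in> gaussian \<Longrightarrow> y \<in> gaussian \<Longrightarrow> x * y \<in> gaussian"
  "x \<in> gaussian \<Longrightarrow> cnj x \<in> gaussian"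
  "1 \<in> gaussian" "0 \<in> gaussian" "2 \<in> gaussian" "3 \<in> gaussian"
  by (auto simp: gaussian_def)

lemma finite_gaussian: "finite {z \<in> gaussian. (cmod z)\<^sup>2 \<le> C}"
proof -
  define n where "n = \<lceil>C\<rceil>"
  have bound: "\<bar>k\<bar> \<le> n" if "(of_int k)\<^sup>2 \<le> C" for k :: int
  proof -
    have "\<bar>k\<bar> * 1 \<le> \<bar>k\<bar> * \<bar>k\<bar>" by (cases "k = 0") (auto intro!: mult_left_mono simp del: mult_1_right abs_mult_self_eq)
    then have "\<bar>k\<bar> \<le> k\<^sup>2" by (simp add: power2_eq_square)
    then have "real_of_int \<bar>k\<bar> \<le> of_int (k\<^sup>2)" by (simp only: of_int_le_iff)
    also have "\<dots> \<le> of_int n" using that le_of_int_ceiling[of C] unfolding n_def of_int_power by linarith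
    finally show ?thesis by (simp only: of_int_le_iff)
  qed
  have "{z \<in> gaussian. (cmod z)\<^sup>2 \<le> C} \<subseteq> (\<lambda>(k, l). Complex (of_int k) (of_int l)) ` ({-n..n} \<times> {-n..n})"
  proof
    fix z assume z: "z \<in> {z \<in> gaussian. (cmod z)\<^sup>2 \<le> C}"
    then obtain k l where kl: "z = Complex (of_int k) (of_int l)"
      by (auto simp: gaussian_def elim!: Ints_cases intro: complex_eqI) (metis complex.collapse)
    have "(of_int k)\<^sup>2 + (of_int l)\<^sup>2 \<le> C" using z by (simp add: kl cmod_power2)
    then have "(of_int k)\<^sup>2 \<le> C" "(of_int l)\<^sup>2 \<le> C"
      using zero_le_power2[of "real_of_int k"] zero_le_power2[of "real_of_int l"] by linarith+
    then have "\<bar>k\<bar> \<le> n" "\<bar>l\<bar> \<le> n" by (auto intro: bound)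
    then show "z \<in> (\<lambda>(k, l). Complex (of_int k) (of_int l)) ` ({-n..n} \<times> {-n..n})"
      by (auto simp: kl abs_le_iff intro!: image_eqI[of _ _ "(k, l)"])
  qed
  then show ?thesis by (rule finite_subset) auto
qed

lemma finite_integral_mats_bounded: "finite {M \<in> integral_mats. (cmod (fst M))\<^sup>2 \<le> C}"
proof (rule finite_subset)
  show "{M \<in> integral_mats. (cmod (fst M))\<^sup>2 \<le> C} \<subseteq>
     (\<lambda>(\<alpha>, \<beta>). (\<alpha>, of_real (sqrt 3) * \<beta>)) ` ({z \<in> gaussian. (cmod z)\<^sup>2 \<le> C} \<times> {z \<in> gaussian. (cmod z)\<^sup>2 \<le> C})"
  proof
    fix M assume "M \<in> {M \<in> integral_mats. (cmod (fst M))\<^sup>2 \<le> C}"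
    then obtain \<alpha> \<beta> where M: "M = (\<alpha>, of_real (sqrt 3) * \<beta>)" "\<alpha> \<in> gaussian" "\<beta> \<in> gaussian"
      "M \<in> su11" "(cmod \<alpha>)\<^sup>2 \<le> C" by (auto simp: integral_mats_def)
    then have "(cmod \<alpha>)\<^sup>2 = 1 + 3 * (cmod \<beta>)\<^sup>2"
      by (simp add: su11_def norm_mult power_mult_distrib)
    then have "(cmod \<beta>)\<^sup>2 \<le> C" using M(5) zero_le_power2[of "cmod \<beta>"] by linarith
    then show "M \<in> (\<lambda>(\<alpha>, \<beta>). (\<alpha>, of_real (sqrt 3) * \<beta>)) ` ({z \<in> gaussian. (cmod z)\<^sup>2 \<le> C} \<times> {z \<in> gaussian. (cmod z)\<^sup>2 \<le> C})"
      using M by auto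
  qed
qed (intro finite_imageI finite_cartesian_product finite_gaussian)

text \<open>
  By \<open>mob_boundary_identity\<close>, the denominator at \<open>z\<close> is bounded when \<open>z\<close> and its image stay away
  from the circle, and the denominator is at least \<open>|\<alpha>| - |\<beta>| |z| \<ge> |\<alpha>| (1 - r)\<close>.
\<close>

lemma entry_bound:
  assumes M: "M \<in> su11" and r: "r < 1" and z: "cmod z \<le> r" and y: "cmod (mob M z) \<le> r"
  shows "(cmod (fst M))\<^sup>2 \<le> 1 / ((1 - r)\<^sup>2 * (1 - r\<^sup>2))"
proof -
  obtain \<alpha> \<beta> where M': "M = (\<alpha>, \<beta>)" by (metis surj_pair)
  have r0: "r \<ge> 0" using z norm_ge_zero order_trans by blast
  then have r1: "1 - r\<^sup>2 > 0" using r by (simp add: abs_square_less_1)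
  have "cmod \<alpha> * (1 - r) = cmod \<alpha> - cmod \<alpha> * r" by (simp add: algebra_simps)
  also have "\<dots> \<le> cmod \<alpha> - cmod \<beta> * cmod z"
    using su11_norm_less[of \<alpha> \<beta>] M M' z by (auto intro: mult_mono)
  also have "\<dots> \<le> cmod (denom M z)"
    using norm_diff_ineq[of "cnj \<alpha>" "cnj \<beta> * z"] by (simp add: M' norm_mult add.commute)
  finally have "(cmod \<alpha> * (1 - r))\<^sup>2 \<le> (cmod (denom M z))\<^sup>2"
    using r by (intro power_mono) auto
  then have "(cmod \<alpha>)\<^sup>2 * ((1 - r)\<^sup>2 * (1 - r\<^sup>2)) \<le> (cmod (denom M z))\<^sup>2 * (1 - r\<^sup>2)"
    using r1 by (simp add: power_mult_distrib mult.assoc [symmetric])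
  also have "\<dots> \<le> (cmod (denom M z))\<^sup>2 * (1 - (cmod (mob M z))\<^sup>2)"
    using y by (intro mult_left_mono) (auto intro: power_mono)
  also have "\<dots> = 1 - (cmod z)\<^sup>2"
    using mob_boundary_identity[OF M, of z] z r by (simp add: mult.commute)
  also have "\<dots> \<le> 1" by simp
  finally show ?thesis using r r1 by (simp add: M' le_divide_eq)
qed

text \<open>
  Proper discontinuity: by \<open>entry_bound\<close> such isometries come from integral matrices with bounded
  entries.
\<close>

lemma finitely_many_meet_compact:
  assumes K: "compact K" "K \<subseteq> hplane"
  shows "finite {g \<in> disc_iso ` integral_mats. \<exists>z\<in>K. g z \<in> K}"
proof (cases "K = {}")
  case False
  obtain z0 where z0: "z0 \<in> K" "\<forall>z\<in>K. cmod z \<le> cmod z0"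
    using continuous_attains_sup[OF K(1) False, of cmod] by (auto intro: continuous_intros)
  define r where "r = cmod z0"
  have r: "r < 1" "\<And>z. z \<in> K \<Longrightarrow> cmod z \<le> r" using z0 K(2) by (auto simp: r_def hplane_def)
  have "{g \<in> disc_iso ` integral_mats. \<exists>z\<in>K. g z \<in> K} \<subseteq>
      disc_iso ` {M \<in> integral_mats. (cmod (fst M))\<^sup>2 \<le> 1 / ((1 - r)\<^sup>2 * (1 - r\<^sup>2))}"
  proof
    fix g assume "g \<in> {g \<in> disc_iso ` integral_mats. \<exists>z\<in>K. g z \<in> K}"
    then obtain M z where M: "g = disc_iso M" "M \<in> integral_mats" "z \<in> K" "disc_iso M z \<in> K" by auto
    then have "mob M z \<in> K" using K(2) by (auto simp: disc_iso_def)
    then have "(cmod (fst M))\<^sup>2 \<le> 1 / ((1 - r)\<^sup>2 * (1 - r\<^sup>2))"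
      using M r by (intro entry_bound[of M r z]) (auto simp: integral_mats_def)
    then show "g \<in> disc_iso ` {M \<in> integral_mats. (cmod (fst M))\<^sup>2 \<le> 1 / ((1 - r)\<^sup>2 * (1 - r\<^sup>2))}"
      using M by auto
  qed
  then show ?thesis by (rule finite_subset) (intro finite_imageI finite_integral_mats_bounded)
qed auto

text \<open>
  The topology of pointwise convergence is again \<open>T\<^sub>1\<close>.
\<close>

lemma closed_finite_function_set:
  fixes A :: "('a \<Rightarrow> 'b::t1_space) set"
  assumes "finite A"
  shows "closed A"
  using assms
proof induction
  case (insert g A)
  have "{g} = (\<Inter>i. (\<lambda>f. f i) -` {g i})" by (auto simp: fun_eq_iff)
  moreover have "closed (\<Inter>i. (\<lambda>f::'a \<Rightarrow> 'b. f i) -` {g i})"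
    by (intro closed_INT ballI closed_vimage) auto
  ultimately have "closed ({g} \<union> A)" using insert by (simp only: closed_Un)
  then show ?case by simp
qed simp

text \<open>
  The condition that \<open>0\<close> is moved into a ball of radius \<open>r < 1\<close> is open, and only finitely many
  elements satisfy it.
\<close>

lemma discrete_integral_mats:
  assumes "G \<subseteq> disc_iso ` integral_mats"
  shows "discrete G"
proof (rule discreteI)
  fix g assume g: "g \<in> G"
  then obtain M where M: "g = disc_iso M" "M \<in> integral_mats" using assms by auto
  have "g 0 \<in> hplane" using M mob_hplane[of M 0] by (simp add: disc_iso_def integral_mats_def hplane_def)
  then obtain r where r: "cmod (g 0) < r" "r < 1" using dense by (auto simp: hplane_def)
  then have r0: "r > 0" using norm_ge_zero order_le_less_trans by blast
  define U where "U = (\<lambda>f::complex\<Rightarrow>complex. f 0) -` ball 0 r"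
  have U: "open U" unfolding U_def by (intro open_vimage) auto
  have "finite (U \<inter> G)"
  proof (rule finite_subset)
    show "U \<inter> G \<subseteq> {g \<in> disc_iso ` integral_mats. \<exists>z\<in>cball 0 r. g z \<in> cball 0 r}"
      using assms r0 by (auto simp: U_def intro!: bexI[of _ 0] simp del: mob.simps)
    show "finite {g \<in> disc_iso ` integral_mats. \<exists>z\<in>cball 0 r. g z \<in> cball 0 r}"
      using r by (intro finitely_many_meet_compact) (auto simp: hplane_def)
  qed
  then have "open (U - (U \<inter> G - {g}))" using U by (intro open_Diff closed_finite_function_set) auto
  moreover have "(U - (U \<inter> G - {g})) \<inter> G = {g}" using g r by (auto simp: U_def)
  ultimately show "g isolated_in G" using g unfolding isolated_in_def by blast
qed

lemma integral_mats_mmul: 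
  assumes "M \<in> integral_mats" "N \<in> integral_mats"
  shows "mmul M N \<in> integral_mats"
proof -
  obtain a b where M: "M = (a, of_real (sqrt 3) * b)" "a \<in> gaussian" "b \<in> gaussian" "M \<in> su11"
    using assms(1) by (auto simp: integral_mats_def)
  obtain c d where N: "N = (c, of_real (sqrt 3) * d)" "c \<in> gaussian" "d \<in> gaussian" "N \<in> su11"
    using assms(2) by (auto simp: integral_mats_def)
  have "mmul M N = (a * c + (complex_of_real (sqrt 3) * complex_of_real (sqrt 3)) * (b * cnj d),
      of_real (sqrt 3) * (a * d + b * cnj c))"
    by (simp add: M(1) N(1) algebra_simps)
  also have "\<dots> = (a * c + 3 * (b * cnj d), of_real (sqrt 3) * (a * d + b * cnj c))"
    by (simp only: of_real_sqrt3)
  finally have "mmul M N = \<dots>" .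
  moreover have "a * c + 3 * (b * cnj d) \<in> gaussian" "a * d + b * cnj c \<in> gaussian"
    using M N by (auto intro!: gaussian_closed)
  moreover have "mmul M N \<in> su11" using M N by (intro su11_mmul)
  ultimately show ?thesis unfolding integral_mats_def by blast
qed

lemma word_mat_integral_mats: "w \<in> lists letters \<Longrightarrow> word_mat w \<in> integral_mats"
proof (induction w)
  case Nil
  have "(1, 0) = (1, of_real (sqrt 3) * 0::complex)" by simp
  then show ?case unfolding integral_mats_def using gaussian_closed su11_one by fastforce
next
  case (Cons u w)
  have "u \<in> gaussian" using Cons by (auto simp: letters_def gaussian_def)
  then have "gen u \<in> integral_mats" using Cons gen_su11 gaussian_closed by (auto simp: integral_mats_def gen_def)
  then show ?case using Cons by (simp add: integral_mats_mmul)
qed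

section \<open>The group and the kernel of the height\<close>

lemma word_subgroup:
  assumes W: "W \<subseteq> lists letters" "[] \<in> W"
    and append: "\<And>w w'. w \<in> W \<Longrightarrow> w' \<in> W \<Longrightarrow> w @ w' \<in> W"
    and inverse: "\<And>w. w \<in> W \<Longrightarrow> word_inv w \<in> W"
  shows "subgroup (disc_iso ` word_mat ` W) isom_plus"
proof (rule group.subgroupI[OF group_isom_plus])
  have su11: "word_mat w \<in> su11" if "w \<in> W" for w using that W(1) word_mat_su11 by blast
  show "disc_iso ` word_mat ` W \<subseteq> carrier isom_plus"
    unfolding image_image using su11 disc_iso_isom_plus by blast
  show "disc_iso ` word_mat ` W \<noteq> {}" using W(2) by auto
  fix g assume "g \<in> disc_iso ` word_mat ` W"
  then obtain w where w: "w \<in> W" "g = disc_iso (word_mat w)" by auto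
  then have "inv\<^bsub>isom_plus\<^esub> g = disc_iso (word_mat (word_inv w))"
    using W(1) su11 by (subst word_mat_word_inv) (auto simp: disc_iso_minv)
  then show "inv\<^bsub>isom_plus\<^esub> g \<in> disc_iso ` word_mat ` W"
    using inverse[OF w(1)] by simp
  fix h assume "h \<in> disc_iso ` word_mat ` W"
  then obtain w' where w': "w' \<in> W" "h = disc_iso (word_mat w')" by auto
  have "g \<otimes>\<^bsub>isom_plus\<^esub> h = disc_iso (word_mat (w @ w'))"
    using w w' su11 by (simp add: word_mat_append disc_iso_mmul)
  then show "g \<otimes>\<^bsub>isom_plus\<^esub> h \<in> disc_iso ` word_mat ` W"
    using append[OF w(1) w'(1)] by simp
qed

definition schottky_group :: "(complex \<Rightarrow> complex) set" where
  "schottky_group = disc_iso ` word_mat ` lists letters"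

definition height_kernel :: "(complex \<Rightarrow> complex) set" where
  "height_kernel = disc_iso ` word_mat ` {w \<in> lists letters. height w = 0}"

lemma subgroup_schottky_group: "subgroup schottky_group isom_plus"
  unfolding schottky_group_def by (rule word_subgroup) (auto simp: word_inv_letters simp flip: append_in_lists_conv)

lemma subgroup_height_kernel: "subgroup height_kernel isom_plus"
  unfolding height_kernel_def
  by (rule word_subgroup) (auto simp: word_inv_letters simp flip: append_in_lists_conv)

lemma height_kernel_subset: "height_kernel \<subseteq> schottky_group"
  by (auto simp: height_kernel_def schottky_group_def)

lemma not_loxodromic_one: "\<not> loxodromic \<one>\<^bsub>isom_plus\<^esub>"
proof -
  have "\<one>\<^bsub>isom_plus\<^esub> 0 = 0" "0 \<in> hplane" by (simp_all add: isom_plus_one hplane_def)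
  then show ?thesis unfolding loxodromic_def by blast
qed

text \<open>
  The first alternative carries the height, so that it yields both the pure loxodromy of the group and
  the independence of the height from the word.
\<close>

lemma word_one_or_loxodromic:
  assumes "w \<in> lists letters"
  shows "word_mat w = (1, 0) \<and> height w = 0 \<or> loxodromic (disc_iso (word_mat w))"
  using word_trivial_or_hyperbolic[OF assms] loxodromic_disc_iso word_mat_su11[OF assms] by blast

lemma height_well_defined:
  assumes "w \<in> lists letters" "w' \<in> lists letters" "disc_iso (word_mat w) = disc_iso (word_mat w')"
  shows "height w = height w'"
proof -
  interpret group isom_plus by (rule group_isom_plus)
  have "disc_iso (word_mat (word_inv w @ w')) = inv\<^bsub>isom_plus\<^esub> disc_iso (word_mat w) \<otimes>\<^bsub>isom_plus\<^esub> disc_iso (word_mat w')"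
    using assms by (simp add: word_mat_append word_mat_word_inv disc_iso_mmul disc_iso_minv su11_minv word_mat_su11)
  also have "\<dots> = \<one>\<^bsub>isom_plus\<^esub>"
    unfolding assms(3) using assms by (simp add: disc_iso_isom_plus word_mat_su11)
  finally have "height (word_inv w @ w') = 0"
    using word_one_or_loxodromic[of "word_inv w @ w'"] not_loxodromic_one assms word_inv_letters by fastforce
  then show ?thesis by simp
qed

section \<open>Translation along the axes of the generators\<close>

text \<open>
  Half of the translation length of the generators, the number for which \<open>gen 1\<close> has entries
  \<open>cosh half_length\<close> and \<open>sinh half_length\<close>.
\<close>

definition half_length :: real where
  "half_length = arcosh 2"

lemma cosh_half_length: "cosh half_length = 2" and sinh_half_length: "sinh half_length = sqrt 3" and half_length_pos: "half_length > 0"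
proof -
  show "cosh half_length = 2" by (simp add: half_length_def cosh_arcosh_real)
  show s: "sinh half_length = sqrt 3" by (simp add: half_length_def sinh_arcosh_real)
  have "sinh half_length > 0" by (simp only: s) simp
  then show "half_length > 0" by simp
qed

lemma word_mat_replicate:
  assumes "u \<in> letters"
  shows "word_mat (replicate n u) = (of_real (cosh (n * half_length)), of_real (sinh (n * half_length)) * u)"
proof (induction n)
  case (Suc n)
  have u: "u * cnj u = 1" using cmod_letter[OF assms] by (simp add: complex_norm_square [symmetric])
  have "mmul (gen u) (of_real (cosh (n * half_length)), of_real (sinh (n * half_length)) * u) =
    (of_real (2 * cosh (n * half_length)) + of_real (sqrt 3 * sinh (n * half_length)) * (u * cnj u),
     of_real (2 * sinh (n * half_length) + sqrt 3 * cosh (n * half_length)) * u)"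
    by (simp add: gen_def algebra_simps)
  also have "\<dots> = (of_real (cosh half_length * cosh (n * half_length) + sinh half_length * sinh (n * half_length)),
     of_real (cosh half_length * sinh (n * half_length) + sinh half_length * cosh (n * half_length)) * u)"
    by (simp add: u cosh_half_length sinh_half_length)
  also have "\<dots> = (of_real (cosh (Suc n * half_length)), of_real (sinh (Suc n * half_length)) * u)"
    by (simp add: distrib_right cosh_add sinh_add add.commute)
  finally show ?case using Suc by simp
qed simp

lemma mob_cosh_sinh:
  "mob (of_real (cosh x), of_real (sinh x) * u) z =
     (z + of_real (tanh x) * u) / (of_real (tanh x) * cnj u * z + 1)"
proof -
  have c: "complex_of_real (cosh x) \<noteq> 0" by simp
  have "mob (of_real (cosh x), of_real (sinh x) * u) z =
     (of_real (cosh x) * (z + of_real (tanh x) * u)) / (of_real (cosh x) * (of_real (tanh x) * cnj u * z + 1))"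
    by (simp add: tanh_def algebra_simps)
  also have "\<dots> = (z + of_real (tanh x) * u) / (of_real (tanh x) * cnj u * z + 1)"
    by (rule mult_divide_mult_cancel_left[OF c])
  finally show ?thesis .
qed

text \<open>
  In the parametrisation \<open>t \<mapsto> tanh t\<close> of the real diameter, the powers of \<open>a\<close> translate \<open>t\<close>; this is
  the addition theorem.
\<close>

lemma mob_real_axis:
  assumes "u \<in> {1, -1}"
  shows "mob (word_mat (replicate n u)) (of_real (tanh t)) = of_real (tanh (t + Re u * n * half_length))"
proof -
  obtain s :: real where s: "u = of_real s" "s = 1 \<or> s = -1"
    using assms by (metis insertE of_real_1 of_real_minus singletonD)
  have t: "tanh (s * n * half_length) = s * tanh (n * half_length)" using s(2) by auto
  have u: "u \<in> letters" using assms by (auto simp: letters_def)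
  have "mob (word_mat (replicate n u)) (of_real (tanh t)) =
      of_real ((tanh t + tanh (s * n * half_length)) / (1 + tanh t * tanh (s * n * half_length)))"
    unfolding t word_mat_replicate[OF u] mob_cosh_sinh by (simp add: s(1) algebra_simps)
  also have "\<dots> = of_real (tanh (t + s * n * half_length))"
    by (subst tanh_add) simp_all
  finally show ?thesis by (simp add: s(1))
qed

text \<open>
  The positive half of the axis of \<open>a\<close>, parametrised by arc length: with the curvature \<open>-1\<close> metric the
  point \<open>tanh (t / 2)\<close> is at distance \<open>t\<close> from \<open>0\<close>.
\<close>

definition axis_ray :: "real \<Rightarrow> complex" where
  "axis_ray t = of_real (tanh (t / 2))"

lemma geodesic_ray_axis_ray: "geodesic_ray axis_ray"
  unfolding geodesic_ray_def
proof (intro conjI allI impI)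
  show "axis_ray \<in> {0..} \<rightarrow> hplane"
    by (auto simp: axis_ray_def hplane_def tanh_real_lt_1 tanh_real_gt_neg1 abs_less_iff)
  fix s t :: real
  define x y where "x = s / 2" and "y = t / 2"
  have sech: "1 - (tanh a)\<^sup>2 = 1 / (cosh a)\<^sup>2" for a :: real
  proof -
    have "1 / (cosh a)\<^sup>2 = ((cosh a)\<^sup>2 - (sinh a)\<^sup>2) / (cosh a)\<^sup>2" by (simp add: cosh_square_eq)
    then show ?thesis by (simp add: tanh_def power_divide diff_divide_distrib)
  qed
  have "sinh (x - y) = sinh x * cosh y - cosh x * sinh y" by (rule sinh_diff)
  then have "tanh x - tanh y = sinh (x - y) / (cosh x * cosh y)"
    by (simp add: tanh_def diff_divide_distrib)
  then have 1: "(tanh x - tanh y)\<^sup>2 / ((1 - (tanh x)\<^sup>2) * (1 - (tanh y)\<^sup>2)) = (sinh (x - y))\<^sup>2"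
    unfolding sech by (simp add: power_divide power_mult_distrib)
  have 2: "cmod (axis_ray s - axis_ray t) = \<bar>tanh x - tanh y\<bar>" "cmod (axis_ray s) = \<bar>tanh x\<bar>" "cmod (axis_ray t) = \<bar>tanh y\<bar>"
    by (simp_all only: axis_ray_def x_def y_def norm_of_real flip: of_real_diff)
  have "hdist (axis_ray s) (axis_ray t) =
      arcosh (1 + 2 * ((tanh x - tanh y)\<^sup>2 / ((1 - (tanh x)\<^sup>2) * (1 - (tanh y)\<^sup>2))))"
    unfolding hdist_def 2 power2_abs by simp
  also have "\<dots> = arcosh (1 + 2 * (sinh (x - y))\<^sup>2)" unfolding 1 ..
  also have "1 + 2 * (sinh (x - y))\<^sup>2 = cosh (2 * (x - y))"
    unfolding cosh_double by (simp add: cosh_square_eq)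
  also have "cosh (2 * (x - y)) = cosh \<bar>s - t\<bar>"
    by (simp add: x_def y_def cosh_real_abs)
  finally show "hdist (axis_ray s) (axis_ray t) = \<bar>s - t\<bar>" by (simp only: arcosh_cosh_real abs_ge_zero)
qed

lemma axis_ray_tendsto: "(axis_ray \<longlongrightarrow> 1) at_top"
proof -
  have "filterlim (\<lambda>t::real. t / 2) at_top at_top"
    by (rule filterlim_at_top_mult_tendsto_pos[of "\<lambda>_. 1/2" "1/2", simplified]) (auto simp: filterlim_ident)
  then have "((\<lambda>t::real. tanh (t / 2)) \<longlongrightarrow> 1) at_top"
    by (rule filterlim_compose[OF tanh_real_at_top])
  then have "((\<lambda>t. complex_of_real (tanh (t / 2))) \<longlongrightarrow> of_real 1) at_top"
    by (rule tendsto_of_real)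
  then show ?thesis by (simp add: axis_ray_def[abs_def])
qed

section \<open>A limit point that is not conical\<close>

text \<open>
  The ray on the axis of \<open>a\<close> is a counterexample to the condition in the definition of conical limit
  points. Applying a power of \<open>a\<close> brings the intersection of \<open>\<gamma>\<^sub>k K\<close> with the axis back to a
  fundamental segment for \<open>a\<close>, and the height of the product remembers the power.
\<close>

lemma one_not_conical: "1 \<notin> conical_limit_set height_kernel"
proof
  interpret group isom_plus by (rule group_isom_plus)
  assume "1 \<in> conical_limit_set height_kernel"
  then obtain K and \<gamma> :: "nat \<Rightarrow> complex \<Rightarrow> complex" where K: "compact K" "K \<subseteq> hplane"
    and \<gamma>: "inj \<gamma>" "range \<gamma> \<subseteq> height_kernel" "\<And>k. \<gamma> k ` K \<inter> axis_ray ` {0..} \<noteq> {}"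
    using geodesic_ray_axis_ray axis_ray_tendsto unfolding conical_limit_set_def by blast
  have "\<forall>k. \<exists>w. w \<in> lists letters \<and> height w = 0 \<and> \<gamma> k = disc_iso (word_mat w)"
    using \<gamma>(2) by (auto simp: height_kernel_def)
  then obtain w where w: "\<And>k. w k \<in> lists letters" "\<And>k. height (w k) = 0"
    "\<And>k. \<gamma> k = disc_iso (word_mat (w k))" by metis
  have "\<forall>k. \<exists>z t. z \<in> K \<and> t \<ge> 0 \<and> \<gamma> k z = axis_ray t" using \<gamma>(3) by fastforce
  then obtain z t where z: "\<And>k. z k \<in> K" and t: "\<And>k. t k \<ge> 0" "\<And>k. \<gamma> k (z k) = axis_ray (t k)"
    by metis
  \<comment> \<open>the number of fundamental segments of \<open>a\<close> between 0 and the intersection point\<close>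
  define n where "n k = nat \<lfloor>t k / 2 / half_length\<rfloor>" for k
  define a where "a k = replicate (n k) (- 1 :: complex)" for k
  define h where "h k = disc_iso (word_mat (a k @ w k))" for k
  have a: "a k \<in> lists letters" for k by (auto simp: a_def letters_def)
  have height_a: "height (a k) = - real (n k)" for k
    by (simp add: a_def height_def sum_list_replicate)
  have h: "h k = disc_iso (word_mat (a k)) \<otimes>\<^bsub>isom_plus\<^esub> \<gamma> k" for k
    using a w by (simp add: h_def word_mat_append disc_iso_mmul word_mat_su11)
  \<comment> \<open>a fundamental segment for \<open>a\<close> on its axis\<close>
  define S where "S = complex_of_real ` {0..tanh half_length}"
  have S: "compact S" "S \<subseteq> hplane"
    unfolding S_def
    by (intro compact_continuous_image continuous_intros compact_Icc)
       (use tanh_real_lt_1[of half_length] in \<open>auto simp: hplane_def\<close>)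
  have hz: "h k (z k) \<in> S" for k
  proof -
    have zk: "z k \<in> hplane" using z K by auto
    have "mob (word_mat (w k)) (z k) = axis_ray (t k)"
      using t(2)[of k] zk by (simp add: w(3) disc_iso_def)
    then have "h k (z k) = mob (word_mat (a k)) (axis_ray (t k))"
      using zk mob_mmul[OF word_mat_su11[OF a] word_mat_su11[OF w(1)], of "z k" k k]
      by (simp add: h_def disc_iso_def word_mat_append hplane_def)
    also have "\<dots> = of_real (tanh (t k / 2 - n k * half_length))"
      unfolding a_def axis_ray_def by (subst mob_real_axis) simp_all
    finally have "h k (z k) = of_real (tanh (t k / 2 - n k * half_length))" .
    moreover have "real (n k) \<le> t k / 2 / half_length" "t k / 2 / half_length < real (n k) + 1"
      using t(1)[of k] half_length_pos unfolding n_def by (auto simp: floor_less_iff)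
    then have "0 \<le> t k / 2 - n k * half_length" "t k / 2 - n k * half_length \<le> half_length"
      using half_length_pos by (auto simp: field_simps)
    ultimately show ?thesis by (auto simp: S_def)
  qed
  have "range h \<subseteq> {g \<in> disc_iso ` integral_mats. \<exists>z\<in>K \<union> S. g z \<in> K \<union> S}"
    using z hz a w(1) by (fastforce simp: h_def word_mat_integral_mats)
  moreover have "finite \<dots>"
    using K S by (intro finitely_many_meet_compact) auto
  ultimately have "finite (range h)" by (rule finite_subset)
  moreover have "inj h"
  proof (rule injI)
    fix k l assume kl: "h k = h l"
    then have "height (a k @ w k) = height (a l @ w l)"
      unfolding h_def using a w(1) by (intro height_well_defined) auto
    then have "n k = n l" by (simp add: height_a w(2))
    then have "a k = a l" by (simp add: a_def)
    then have "\<gamma> k = \<gamma> l"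
      using kl a w by (simp add: h disc_iso_isom_plus word_mat_su11)
    then show "k = l" using \<gamma>(1) by (simp add: inj_eq)
  qed
  ultimately show False using finite_imageD by blast
qed

text \<open>
  The generator \<open>b\<close> fixes \<open>\<i>\<close>, so its conjugate by \<open>a\<^sup>n\<close>, which has height \<open>0\<close>, fixes
  \<open>a\<^sup>n \<i>\<close>; these points converge to the attracting fixed point of \<open>a\<close>.
\<close>

lemma one_in_limit_set: "1 \<in> limit_set height_kernel"
proof -
  define A where "A n = word_mat (replicate n 1)" for n
  define B where "B = gen \<i>"
  have letters: "1 \<in> letters" "\<i> \<in> letters" by (auto simp: letters_def)
  have A: "A n \<in> su11" for n unfolding A_def by (intro word_mat_su11) (auto simp: letters)
  have B: "B \<in> su11" unfolding B_def by (rule gen_su11[OF letters(2)])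
  have "mob (A n) \<i> \<in> (\<Union>g\<in>{g \<in> height_kernel. loxodromic g}. fixed_points_inf g)" for n
  proof -
    define w where "w = replicate n 1 @ [\<i>] @ word_inv (replicate n 1)"
    have w: "w \<in> lists letters"
      unfolding w_def using letters by (auto intro!: word_inv_letters)
    have hw: "height w = 0" by (simp add: w_def)
    have M: "word_mat w = mmul (A n) (mmul B (minv (A n)))"
      unfolding w_def A_def B_def using letters
      by (subst word_mat_append, subst word_mat_append, subst word_mat_word_inv) (auto simp: replicate_in_lists)
    have "Re (fst (word_mat w)) = Re (fst (mmul B (mmul (minv (A n)) (A n))))"
      unfolding M by (subst half_trace_cyclic) (simp add: mmul_assoc)
    then have "Re (fst (word_mat w)) = 2" by (simp add: mmul_minv[OF A] B_def gen_def)
    then have lox: "loxodromic (disc_iso (word_mat w))"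
      using word_mat_su11[OF w] by (intro loxodromic_disc_iso) auto
    have norm: "cmod (mob (A n) \<i>) = 1"
    proof -
      have "(1 - (cmod (mob (A n) \<i>))\<^sup>2) * (cmod (denom (A n) \<i>))\<^sup>2 = 0"
        using mob_boundary_identity[OF A, of \<i> n] by simp
      then have "(cmod (mob (A n) \<i>))\<^sup>2 = 1"
        using denom_nonzero[OF A, of \<i> n] by simp
      then show ?thesis by (simp add: abs_square_eq_1)
    qed
    have "2 + sqrt 3 \<noteq> 0" using real_sqrt_ge_zero[of 3] by linarith
    then have "complex_of_real (2 + sqrt 3) \<noteq> 0" by (simp only: of_real_eq_0_iff not_False_eq_True)
    moreover have "mob B \<i> = (of_real (2 + sqrt 3) * \<i>) / of_real (2 + sqrt 3)"
      by (simp add: B_def gen_def algebra_simps)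
    ultimately have "mob B \<i> = \<i>" by simp
    moreover have "mob (minv (A n)) (mob (A n) \<i>) = \<i>"
      using mob_mmul[OF su11_minv[OF A] A, of \<i> n n] by (simp add: mmul_minv[OF A])
    ultimately have "mob (word_mat w) (mob (A n) \<i>) = mob (A n) \<i>"
      unfolding M using norm
      by (simp add: mob_mmul A B su11_minv su11_mmul)
    then have "mob (A n) \<i> \<in> fixed_points_inf (disc_iso (word_mat w))"
      using norm by (simp add: fixed_points_inf_disc_iso word_mat_su11[OF w])
    moreover have "disc_iso (word_mat w) \<in> height_kernel" using w hw by (auto simp: height_kernel_def)
    ultimately show ?thesis using lox by blast
  qed
  moreover have "(\<lambda>n. mob (A n) \<i>) \<longlonglongrightarrow> 1"
  proof -
    have "filterlim (\<lambda>n. real n * half_length) at_top sequentially"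
      using half_length_pos filterlim_real_sequentially
      by (intro filterlim_at_top_mult_tendsto_pos[OF tendsto_const])
    then have lim: "(\<lambda>n. tanh (real n * half_length)) \<longlonglongrightarrow> 1"
      by (rule filterlim_compose[OF tanh_real_at_top])
    have "(\<lambda>n. (\<i> + of_real (tanh (real n * half_length))) / (of_real (tanh (real n * half_length)) * \<i> + 1)) \<longlonglongrightarrow>
        (\<i> + of_real 1) / (of_real 1 * \<i> + 1)"
      by (intro tendsto_intros lim) (simp add: complex_eq_iff)
    moreover have "(\<i> + of_real 1) / (of_real 1 * \<i> + 1) = (1::complex)"
      by (simp add: complex_eq_iff)
    moreover have "(\<i> + of_real (tanh (n * half_length))) / (of_real (tanh (n * half_length)) * \<i> + 1) = mob (A n) \<i>" for n
      using mob_cosh_sinh[of "n * half_length" 1 \<i>] by (simp add: A_def word_mat_replicate letters del: mob.simps)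
    ultimately show ?thesis by (simp only:)
  qed
  ultimately show ?thesis
    unfolding limit_set_def closure_sequential by (intro exI[of _ "\<lambda>n. mob (A n) \<i>"] conjI allI)
qed

section \<open>The group is non-elementary, and the conclusion\<close>

text \<open>
  Two of the cosets \<open>H u\<^sup>n\<close> coincide, and the quotient of the two powers lies in \<open>H\<close>.
\<close>

lemma finite_index_power:
  assumes H: "subgroup H (isom_plus\<lparr>carrier := schottky_group\<rparr>)"
    and fin: "finite (rcosets\<^bsub>isom_plus\<lparr>carrier := schottky_group\<rparr>\<^esub> H)"
    and u: "u \<in> letters"
  obtains m where "m > 0" "disc_iso (word_mat (replicate m u)) \<in> H"
proof -
  let ?G = "isom_plus\<lparr>carrier := schottky_group\<rparr>"
  interpret G: group ?G
    by (rule subgroup.subgroup_is_group[OF subgroup_schottky_group group_isom_plus])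
  define e where "e n = disc_iso (word_mat (replicate n u))" for n
  have e: "e n \<in> carrier ?G" for n
    using u by (auto simp: e_def schottky_group_def replicate_in_lists intro!: imageI)
  have e_add: "e (m + n) = e m \<otimes>\<^bsub>?G\<^esub> e n" for m n
    using u by (simp add: e_def replicate_add word_mat_append disc_iso_mmul word_mat_su11 replicate_in_lists)
  have "H \<subseteq> carrier ?G" using H by (rule subgroup.subset)
  then have "range (\<lambda>n. H #>\<^bsub>?G\<^esub> e n) \<subseteq> rcosets\<^bsub>?G\<^esub> H" using e G.rcosetsI by blast
  then have "finite (range (\<lambda>n. H #>\<^bsub>?G\<^esub> e n))" using fin finite_subset by blast
  then have "\<not> inj (\<lambda>n. H #>\<^bsub>?G\<^esub> e n)" using finite_imageD by blast
  then obtain i j where ij: "i < j" "H #>\<^bsub>?G\<^esub> e i = H #>\<^bsub>?G\<^esub> e j"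
    unfolding inj_def by (metis linorder_neqE_nat)
  have "e j \<in> H #>\<^bsub>?G\<^esub> e i" unfolding ij(2) using G.rcos_self[OF e H] by simp
  then obtain x where x: "x \<in> H" "e j = x \<otimes>\<^bsub>?G\<^esub> e i" by (auto simp: r_coset_def)
  then have "e (j - i) \<otimes>\<^bsub>?G\<^esub> e i = x \<otimes>\<^bsub>?G\<^esub> e i" using e_add[of "j - i" i] ij(1) by simp
  then have "e (j - i) = x" using G.right_cancel e x(1) subgroup.mem_carrier[OF H] by metis
  then show thesis using that[of "j - i"] ij(1) x(1) by (simp add: e_def)
qed

text \<open>
  An abelian subgroup of finite index would contain commuting powers of \<open>a\<close> and \<open>b\<close>. The images of \<open>0\<close>
  under their two products are \<open>(x + \<i> * y) / (1 \<plusminus> \<i> * x * y)\<close> with \<open>x\<close> and \<open>y\<close> positive, and these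
  differ.
\<close>

lemma non_elementary_schottky_group: "non_elementary schottky_group"
  unfolding non_elementary_def
proof
  let ?G = "isom_plus\<lparr>carrier := schottky_group\<rparr>"
  assume "virtually_abelian ?G"
  then obtain H where H: "subgroup H ?G" "comm_group (?G\<lparr>carrier := H\<rparr>)" "finite (rcosets\<^bsub>?G\<^esub> H)"
    unfolding virtually_abelian_def by blast
  have letters: "1 \<in> letters" "\<i> \<in> letters" by (auto simp: letters_def)
  obtain m where m: "m > 0" "disc_iso (word_mat (replicate m 1)) \<in> H"
    using finite_index_power[OF H(1,3) letters(1)] by blast
  obtain n where n: "n > 0" "disc_iso (word_mat (replicate n \<i>)) \<in> H"
    using finite_index_power[OF H(1,3) letters(2)] by blast
  let ?A = "word_mat (replicate m 1)" and ?B = "word_mat (replicate n \<i>)"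
  have AB: "?A \<in> su11" "?B \<in> su11" using letters by (auto intro!: word_mat_su11 simp: replicate_in_lists)
  define x y where "x = tanh (m * half_length)" and "y = tanh (n * half_length)"
  have xy: "x > 0" "y > 0" using m n half_length_pos by (simp_all add: x_def y_def)
  have "disc_iso ?A \<otimes>\<^bsub>isom_plus\<^esub> disc_iso ?B = disc_iso ?B \<otimes>\<^bsub>isom_plus\<^esub> disc_iso ?A"
    using comm_groupE(4)[OF H(2), of "disc_iso ?A" "disc_iso ?B"] m n by simp
  then have "disc_iso (mmul ?A ?B) 0 = disc_iso (mmul ?B ?A) 0"
    using AB by (simp add: disc_iso_mmul)
  then have "mob ?A (mob ?B 0) = mob ?B (mob ?A 0)"
    using AB by (simp add: disc_iso_def hplane_def mob_mmul del: mob.simps)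
  then have eq: "(of_real x + \<i> * of_real y) / (1 + \<i> * of_real (x * y)) =
      (of_real x + \<i> * of_real y) / (1 - \<i> * of_real (x * y))"
    unfolding word_mat_replicate[OF letters(1)] word_mat_replicate[OF letters(2)] mob_cosh_sinh x_def[symmetric] y_def[symmetric]
    by (simp add: algebra_simps)
  moreover have "of_real x + \<i> * of_real y \<noteq> (0::complex)" using xy by (auto simp: complex_eq_iff)
  ultimately have "1 + \<i> * complex_of_real (x * y) = 1 - \<i> * of_real (x * y)"
    unfolding divide_inverse by (metis inverse_eq_iff_eq mult_left_cancel)
  then have "x * y = - (x * y)" by (simp add: complex_eq_iff)
  then show False using xy by simp
qed

theorem proposition3:
  shows "\<exists>\<Gamma> \<Phi> \<Theta>.
    fuchsian_group \<Gamma> \<and> purely_loxodromic \<Gamma> \<and> non_elementary \<Gamma> \<and>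
    subgroup \<Phi> (isom_plus\<lparr>carrier := \<Gamma>\<rparr>) \<and> \<Phi> \<noteq> {\<one>\<^bsub>isom_plus\<^esub>} \<and>
    subgroup \<Theta> (isom_plus\<lparr>carrier := \<Gamma>\<rparr>) \<and> \<Theta> \<noteq> {\<one>\<^bsub>isom_plus\<^esub>} \<and>
    limit_set (\<Phi> \<inter> \<Theta>) - (conical_limit_set \<Phi> \<inter> conical_limit_set \<Theta>) \<noteq> {}"
proof (intro exI conjI)
  show "fuchsian_group schottky_group"
    unfolding fuchsian_group_def using subgroup_schottky_group
    by (intro conjI discrete_integral_mats) (auto simp only: schottky_group_def intro!: image_mono word_mat_integral_mats)
  show "purely_loxodromic schottky_group"
    unfolding purely_loxodromic_def schottky_group_def using word_one_or_loxodromic disc_iso_one by fastforce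
  show "non_elementary schottky_group" by (rule non_elementary_schottky_group)
  show "subgroup height_kernel (isom_plus\<lparr>carrier := schottky_group\<rparr>)" "subgroup height_kernel (isom_plus\<lparr>carrier := schottky_group\<rparr>)"
    using group.subgroup_incl[OF group_isom_plus subgroup_height_kernel subgroup_schottky_group height_kernel_subset] by simp_all
  have "{g \<in> height_kernel. loxodromic g} \<noteq> {}"
    using one_in_limit_set unfolding limit_set_def by (metis SUP_empty closure_empty empty_iff)
  then show "height_kernel \<noteq> {\<one>\<^bsub>isom_plus\<^esub>}" "height_kernel \<noteq> {\<one>\<^bsub>isom_plus\<^esub>}"
    using not_loxodromic_one by (metis (mono_tags, lifting) empty_Collect_eq singletonD)+
  show "limit_set (height_kernel \<inter> height_kernel) - (conical_limit_set height_kernel \<inter> conical_limit_set height_kernel) \<noteq> {}"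
    using one_in_limit_set one_not_conical by auto
qed

end
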